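(* Let $(p_n)_{n\ge1}$ be a sequence in $[0,1]$, and consider the random hypercube $H_2^n(p_n)$ with law $P_{n,p_n}$. (a) Tamper with $H_2^n(p_n)$ by adjoining a uniformly random diameter path, obtaining the law $P_{n,p_n}^{\mathrm{tam}}$; let $N_n^{\mathrm{diam}}$ be the number of diameter paths in an edge configuration. (a-i) If for some constant $\gamma<\frac e2$ one has $p_n\le\frac{\gamma}{n}$ for all sufficiently large $n$, then the tampering is detectable, i.e. $\lim_{n\to\infty}\|P_{n,p_n}-P_{n,p_n}^{\mathrm{tam}}\|_{\mathrm{TV}}=1$; furthermore, the distribution of $N_n^{\mathrm{diam}}$ under $P_{n,p_n}$ converges to the $\delta$-distribution at $0$. (a-ii) If for some constant $\gamma>\frac e2$ one has $p_n\ge\frac{\gamma}{n}$ for all sufficiently large $n$, then the tampering is strongly undetectable, i.e. $\lim_{n\to\infty}\|P_{n,p_n}-P_{n,p_n}^{\mathrm{tam}}\|_{\mathrm{TV}}=0$; equivalently, $N_n^{\mathrm{diam}}$ under $P_{n,p_n}$ satisfies the weak law of large numbers. (b) Tamper with $H_2^n(p_n)$ by adjoining a diameter path chosen uniformly at random among those that start from $0=(0,\dots,0)$, obtaining the law $P_{n,p_n}^{\mathrm{tam},0}$; let $N_n^{\mathrm{diam},0}$ be the number of diameter paths starting from $0$ in an edge configuration. (b-i) If for some constant $\gamma<e$ one has $p_n\le\frac{\gamma}{n}$ for all sufficiently large $n$, then the tampering is detectable, i.e. $\lim_{n\to\infty}\|P_{n,p_n}-P_{n,p_n}^{\mathrm{tam},0}\|_{\mathrm{TV}}=1$;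 furthermore, the distribution of $N_n^{\mathrm{diam},0}$ under $P_{n,p_n}$ converges to the $\delta$-distribution at $0$. (b-ii) If for some constant $\gamma>e$ one has $p_n\ge\frac{\gamma}{n}$ for all sufficiently large $n$, and $\limsup_{n\to\infty}np_n<\infty$, then the tampering is weakly undetectable, i.e. there is $\epsilon>0$ with $\epsilon\le\|P_{n,p_n}-P_{n,p_n}^{\mathrm{tam},0}\|_{\mathrm{TV}}\le1-\epsilon$ for all sufficiently large $n$; in particular, $N_n^{\mathrm{diam},0}$ under $P_{n,p_n}$ does not satisfy the weak law of large numbers. (b-iii) If $\lim_{n\to\infty}np_n=\infty$, then the tampering is strongly undetectable, i.e. $\lim_{n\to\infty}\|P_{n,p_n}-P_{n,p_n}^{\mathrm{tam},0}\|_{\mathrm{TV}}=0$; equivalently, $N_n^{\mathrm{diam},0}$ under $P_{n,p_n}$ satisfies the weak law of large numbers.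
   Context: $H_2^n$ is the $n$-dimensional hypercube graph: vertex set $\{0,1\}^n$, with an edge (element of the edge set $e_n$) joining two vertices iff they differ in exactly one component. An edge configuration is a subset of $e_n$; $\mathcal E_n=2^{e_n}$ is the set of all edge configurations. $H_2^n(p_n)$ is the random graph obtained by deleting each edge of $H_2^n$ with probability $1-p_n$ independently; $P_{n,p_n}$ is its law, a probability measure on $\mathcal E_n$, with expectation $E_{n,p_n}$. A diameter path is a longest geodesic path in $H_2^n$, i.e. a path $\bar x_0\bar x_1\cdots\bar x_n$ of consecutive adjacent vertices with $\bar x_n=(1,\dots,1)-\bar x_0$. Diameter paths are unoriented (a path and its reversal are the same), so there are $2^{n-1}n!$ of them; $n!$ of them start from $0=(0,\dots,0)$ (i.e. have $0$ as an endpoint). An edge configuration contains a diameter path if it contains all $n$ of its edges. $P_{n,p_n}^{\mathrm{tam}}$ is the law on $\mathcal E_n$ of the union of the random configuration with law $P_{n,p_n}$ and the edge set of an independent, uniformly random diameter path. $P_{n,p_n}^{\mathrm{tam},0}$ is defined in the same way, with the diameter path chosen uniformly among those starting from $0$. $\|\cdot\|_{\mathrm{TV}}$ is total variation distance, $\|P-Q\|_{\mathrm{TV}}=\max_{A\subset\mathcal E_n}|P(A)-Q(A)|$. For $N_n=N_n^{\mathrm{diam}}$ or $N_n=N_n^{\mathrm{diam},0}$, the weak law of large numbers for $N_n$ under $P_{n,p_n}$ means: $\lim_{n\to\infty}P_{n,p_n}\left(\left|\frac{N_n}{E_{n,p_n}N_n}-1\right|>\epsilon\right)=0$ for all $\epsilon>0$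 (with $n$ large enough that $E_{n,p_n}N_n>0$). *)

theory Defs
  imports "HOL-Probability.Probability"
begin

section \<open>The hypercube and its diameter paths\<close>

type_synonym vertex = "bool list"
type_synonym edge = "vertex set"

definition hc_vertices :: "nat \<Rightarrow> vertex set" where
  "hc_vertices n = {x. length x = n}"

definition hc_edges :: "nat \<Rightarrow> edge set" where
  "hc_edges n = {{x, y} | x y. x \<in> hc_vertices n \<and> y \<in> hc_vertices n \<and>
     card {i. i < n \<and> x ! i \<noteq> y ! i} = 1}"

definition edge_configs :: "nat \<Rightarrow> edge set set" where
  "edge_configs n = Pow (hc_edges n)"

definition hc_zero :: "nat \<Rightarrow> vertex" where
  "hc_zero n = replicate n False"

text \<open>Pointwise negation sends \<open>x\<close> to its antipode \<open>(1,\<dots>,1) - x\<close>.\<close>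

definition oriented_diam_path :: "nat \<Rightarrow> vertex list \<Rightarrow> bool" where
  "oriented_diam_path n xs \<longleftrightarrow>
     length xs = Suc n \<and> set xs \<subseteq> hc_vertices n \<and>
     (\<forall>i<n. {xs ! i, xs ! Suc i} \<in> hc_edges n) \<and>
     xs ! n = map Not (xs ! 0)"

text \<open>An unoriented path is the class \<open>{xs, rev xs}\<close> of a vertex sequence and its reversal.\<close>

definition diam_paths :: "nat \<Rightarrow> vertex list set set" where
  "diam_paths n = {{xs, rev xs} | xs. oriented_diam_path n xs}"

definition diam_paths0 :: "nat \<Rightarrow> vertex list set set" where
  "diam_paths0 n = {d \<in> diam_paths n. \<exists>xs\<in>d. hd xs = hc_zero n}"

definition path_edges :: "vertex list set \<Rightarrow> edge set" where
  "path_edges d = (\<Union>xs\<in>d. {{xs ! i, xs ! Suc i} | i. Suc i < length xs})"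

definition N_diam :: "nat \<Rightarrow> edge set \<Rightarrow> nat" where
  "N_diam n E = card {d \<in> diam_paths n. path_edges d \<subseteq> E}"

definition N_diam0 :: "nat \<Rightarrow> edge set \<Rightarrow> nat" where
  "N_diam0 n E = card {d \<in> diam_paths0 n. path_edges d \<subseteq> E}"


section \<open>Random hypercube and tampering\<close>

definition hc_law :: "nat \<Rightarrow> real \<Rightarrow> edge set pmf" where
  "hc_law n p = map_pmf (\<lambda>kept. {e \<in> hc_edges n. kept e})
     (Pi_pmf (hc_edges n) False (\<lambda>_. bernoulli_pmf p))"

definition tamper :: "edge set pmf \<Rightarrow> vertex list set set \<Rightarrow> edge set pmf" where
  "tamper P D = map_pmf (\<lambda>(E, d). E \<union> path_edges d) (pair_pmf P (pmf_of_set D))"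

definition hc_law_tam :: "nat \<Rightarrow> real \<Rightarrow> edge set pmf" where
  "hc_law_tam n p = tamper (hc_law n p) (diam_paths n)"

definition hc_law_tam0 :: "nat \<Rightarrow> real \<Rightarrow> edge set pmf" where
  "hc_law_tam0 n p = tamper (hc_law n p) (diam_paths0 n)"

definition tv_dist :: "nat \<Rightarrow> edge set pmf \<Rightarrow> edge set pmf \<Rightarrow> real" where
  "tv_dist n P Q =
     Max ((\<lambda>A. \<bar>measure_pmf.prob P A - measure_pmf.prob Q A\<bar>) ` Pow (edge_configs n))"

definition detectable :: "(nat \<Rightarrow> edge set pmf) \<Rightarrow> (nat \<Rightarrow> edge set pmf) \<Rightarrow> bool" where
  "detectable P Q \<longleftrightarrow> (\<lambda>n. tv_dist n (P n) (Q n)) \<longlonglongrightarrow> 1"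

definition strongly_undetectable ::
    "(nat \<Rightarrow> edge set pmf) \<Rightarrow> (nat \<Rightarrow> edge set pmf) \<Rightarrow> bool" where
  "strongly_undetectable P Q \<longleftrightarrow> (\<lambda>n. tv_dist n (P n) (Q n)) \<longlonglongrightarrow> 0"

definition weakly_undetectable ::
    "(nat \<Rightarrow> edge set pmf) \<Rightarrow> (nat \<Rightarrow> edge set pmf) \<Rightarrow> bool" where
  "weakly_undetectable P Q \<longleftrightarrow>
     (\<exists>\<epsilon>>0. eventually (\<lambda>n. \<epsilon> \<le> tv_dist n (P n) (Q n) \<and> tv_dist n (P n) (Q n) \<le> 1 - \<epsilon>)
        sequentially)"

text \<open>
  If the expectation is \<open>0\<close> for infinitely many \<open>n\<close>, the quotient below is \<open>0\<close> for these \<open>n\<close>, so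
  that the event has probability \<open>1\<close> for \<open>\<epsilon> < 1\<close> and the predicate is false.
\<close>

definition weak_law_large_numbers ::
    "(nat \<Rightarrow> edge set pmf) \<Rightarrow> (nat \<Rightarrow> edge set \<Rightarrow> nat) \<Rightarrow> bool" where
  "weak_law_large_numbers P N \<longleftrightarrow>
     (\<forall>\<epsilon>>0. (\<lambda>n. measure_pmf.prob (P n)
        {E. \<bar>real (N n E) / measure_pmf.expectation (P n) (\<lambda>E. real (N n E)) - 1\<bar> > \<epsilon>})
        \<longlonglongrightarrow> 0)"

definition converges_to_delta0 ::
    "(nat \<Rightarrow> edge set pmf) \<Rightarrow> (nat \<Rightarrow> edge set \<Rightarrow> nat) \<Rightarrow> bool" where
  "converges_to_delta0 P N \<longleftrightarrow>
     weak_conv_m (\<lambda>n. distr (measure_pmf (P n)) borel (\<lambda>E. real (N n E))) (return borel 0)"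


section \<open>Well-definedness of the uniform choices and of the maximum\<close>

lemma finite_hc_vertices: "finite (hc_vertices n)"
  using finite_lists_length_eq[of "UNIV :: bool set" n] by (simp add: hc_vertices_def)

lemma finite_hc_edges: "finite (hc_edges n)"
  by (rule finite_subset[of _ "Pow (hc_vertices n)"])
     (auto simp: hc_edges_def finite_hc_vertices)

lemma finite_diam_paths: "finite (diam_paths n)"
proof -
  have "finite {xs. oriented_diam_path n xs}"
    by (rule finite_subset[OF _ finite_lists_length_eq[OF finite_hc_vertices[of n], of "Suc n"]])
       (auto simp: oriented_diam_path_def)
  moreover have "diam_paths n = (\<lambda>xs. {xs, rev xs}) ` {xs. oriented_diam_path n xs}"
    by (auto simp: diam_paths_def)
  ultimately show ?thesis by simp
qed

lemma diam_paths0_subset: "diam_paths0 n \<subseteq> diam_paths n"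
  by (auto simp: diam_paths0_def)

lemma finite_diam_paths0: "finite (diam_paths0 n)"
  using finite_diam_paths diam_paths0_subset by (rule rev_finite_subset)

lemma diam_paths0_nonempty: "diam_paths0 n \<noteq> {}"
proof -
  define v where "v k = replicate k True @ replicate (n - k) False" for k
  define xs where "xs = map v [0..<Suc n]"
  have v: "v k \<in> hc_vertices n" if "k \<le> n" for k
    using that by (simp add: v_def hc_vertices_def)
  have nth: "xs ! k = v k" if "k \<le> n" for k
    using that by (simp add: xs_def del: upt_Suc)
  have e: "{v i, v (Suc i)} \<in> hc_edges n" if "i < n" for i
  proof -
    have "v k ! j \<longleftrightarrow> j < k" if "k \<le> n" "j < n" for k j
      using that by (simp add: v_def nth_append)
    hence "{j. j < n \<and> v i ! j \<noteq> v (Suc i) ! j} = {i}"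
      using that by auto
    hence "card {j. j < n \<and> v i ! j \<noteq> v (Suc i) ! j} = 1"
      by simp
    moreover have "v i \<in> hc_vertices n" "v (Suc i) \<in> hc_vertices n"
      using that by (simp_all add: v)
    ultimately show ?thesis
      unfolding hc_edges_def by blast
  qed
  have "length xs = Suc n"
    by (simp add: xs_def del: upt_Suc)
  moreover have "set xs \<subseteq> hc_vertices n"
    using v by (auto simp: xs_def simp del: upt_Suc)
  moreover have "xs ! n = map Not (xs ! 0)"
    unfolding nth[of n, OF order_refl] nth[of 0, OF le0] by (simp add: v_def)
  moreover have "\<forall>i<n. {xs ! i, xs ! Suc i} \<in> hc_edges n"
  proof (intro allI impI)
    fix i assume "i < n"
    thus "{xs ! i, xs ! Suc i} \<in> hc_edges n"
      using e[of i] nth[of i] nth[of "Suc i"] by simp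
  qed
  ultimately have "oriented_diam_path n xs"
    unfolding oriented_diam_path_def by blast
  moreover have "hd xs = hc_zero n"
    by (simp add: xs_def hd_map v_def hc_zero_def del: upt_Suc)
  ultimately show ?thesis by (auto simp: diam_paths0_def diam_paths_def)
qed

lemma diam_paths_nonempty: "diam_paths n \<noteq> {}"
  using diam_paths0_nonempty diam_paths0_subset by blast

lemma finite_Pow_edge_configs: "finite (Pow (edge_configs n))"
  by (simp add: edge_configs_def finite_hc_edges)

end

theory Submission
  imports Defs
begin

text \<open>
  For \<open>p > 0\<close> the tampered law has density \<open>X = N / E N\<close> with respect to the original one, because
  adjoining the edges of a path amounts to conditioning on them. Hence the total variation distance
  is \<open>E (1 - X)\<^sup>+\<close>. It tends to \<open>1\<close> if \<open>E N \<rightarrow> 0\<close>, and it is controlled by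
  \<open>E X\<^sup>2\<close>, which is the mean of \<open>p ^ - W\<close> for the number \<open>W\<close> of common edges of two independent
  uniform paths. Two paths from \<open>0\<close> with \<open>m\<close> prescribed common edges are free only between these edges,
  which gives the products of factorials in \<open>overlap_sum\<close>; since \<open>n ^ m (n - m)! \<le> e ^ m n!\<close> and these
  products add up to at most \<open>M (1 + \<delta>) ^ m (n - m)!\<close>, the series converges for \<open>n p \<ge> \<gamma> > e\<close>.
  If the starting point is random as well, the terms with \<open>m > 0\<close> gain a factor of about \<open>2 ^ - n\<close>,
  which moves the threshold to \<open>e / 2\<close>. In the regime of bounded \<open>n p\<close>, the vertex \<open>0\<close> is isolated
  with a probability bounded away from \<open>0\<close>.
\<close>

section \<open>Sums of products of factorials\<close>

text \<open>The power of \<open>q\<close> that counts common edges is not expanded over sets of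
  edges. Splitting off a single common step, with all later ones left inside a power of
  \<open>q\<close>, yields a recursion of the same shape as that of \<open>overlap_sum\<close>. For
  paths from 0 this is direct, because two geodesics from one vertex use a common edge at the same
  time and in the same direction. The obstacle is a second path with another start, which may use an
  edge at any time and backwards. There one shared edge is fixed together with the time and the
  direction of the second passage; from its head on, both paths behave like paths with a common
  start. The cost is a factor of order n ^ 2, harmless against 2 ^ - n. The part of the second path
  before the shared edge survives as the ignored prefix of length \<open>l\<close> in the counting
  lemma. The second moment enters only through quadratic majorants: one makes the distance small,
  one keeps it away from 1, and the third is that of Chebyshev.\<close>

fun fact_conv :: "nat \<Rightarrow> nat \<Rightarrow> real" where
  "fact_conv 0 r = fact r"
| "fact_conv (Suc m) r = (\<Sum>g\<le>r. fact g * fact_conv m (r - g))"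

text \<open>The index \<open>m\<close> is the number of prescribed common edges, which split the remaining
  \<open>b - m\<close> steps into \<open>m + 1\<close> gaps.\<close>

definition overlap_sum :: "real \<Rightarrow> nat \<Rightarrow> real" where
  "overlap_sum q b = (\<Sum>m\<le>b. q ^ m * fact_conv m (b - m))"

lemma fact_conv_nonneg: "fact_conv m r \<ge> 0"
  by (induction m r rule: fact_conv.induct) (auto intro!: sum_nonneg)

text \<open>Unfolded, \<open>fact_conv m r\<close> sums products of m + 1 factorials over all ways
  of writing \<open>r\<close> as an ordered sum of m + 1 natural numbers. Cutting off the first gap
  \<open>j\<close> and the edge that closes it (one step, one factor \<open>q\<close>) leaves the
  same sum for \<open>b - Suc j\<close>; the summand \<open>fact b\<close> is the case without any
  edge.\<close>

lemma overlap_sum_rec: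
  "overlap_sum q b = fact b + q * (\<Sum>j<b. fact j * overlap_sum q (b - Suc j))"
proof (cases b)
  case 0
  then show ?thesis by (simp add: overlap_sum_def)
next
  case (Suc c)
  have "overlap_sum q b = fact b + (\<Sum>m\<le>c. q ^ Suc m * fact_conv (Suc m) (c - m))"
    unfolding overlap_sum_def Suc by (subst sum.atMost_Suc_shift) simp
  also have "(\<Sum>m\<le>c. q ^ Suc m * fact_conv (Suc m) (c - m)) =
     q * (\<Sum>m\<le>c. \<Sum>g\<le>c - m. fact g * (q ^ m * fact_conv m (c - m - g)))"
    by (simp add: sum_distrib_left mult_ac)
  also have "(\<Sum>m\<le>c. \<Sum>g\<le>c - m. fact g * (q ^ m * fact_conv m (c - m - g))) =
     (\<Sum>g\<le>c. \<Sum>m\<le>c - g. fact g * (q ^ m * fact_conv m (c - m - g)))"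
    unfolding sum.Sigma[OF finite_atMost ballI[OF finite_atMost]]
    by (rule sum.reindex_bij_witness[of _ "\<lambda>(a, b). (b, a)" "\<lambda>(a, b). (b, a)"]) auto
  also have "\<dots> = (\<Sum>j<b. fact j * overlap_sum q (b - Suc j))"
    unfolding overlap_sum_def Suc lessThan_Suc_atMost
    by (simp add: sum_distrib_left add.commute)
  finally show ?thesis .
qed

lemma overlap_sum_nonneg: "q \<ge> 0 \<Longrightarrow> overlap_sum q b \<ge> 0"
  by (auto simp: overlap_sum_def intro!: sum_nonneg mult_nonneg_nonneg fact_conv_nonneg)

text \<open>The two end terms give \<open>2 * fact (r - 1)\<close>. Every other term is
  \<open>fact r\<close> divided by a binomial coefficient that is at least
  \<open>r choose 2\<close>, and there are at most \<open>r - 1\<close> such terms, so together they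
  contribute no more than the end terms.\<close>

lemma sum_fact_mult_fact_le:
  assumes "r \<ge> 1"
  shows "(\<Sum>g=1..<r. fact g * fact (r - g) :: real) \<le> 4 * fact r / real r"
proof -
  have inner: "(\<Sum>g=2..<r-1. fact g * fact (r - g) :: real) \<le> 2 * fact r / real r" if "r \<ge> 3"
  proof -
    have *: "(fact g * fact (r - g) :: real) \<le> 2 * fact r / (real r * real (r - 1))"
      if g: "g \<in> {2..<r-1}" for g
    proof -
      have gr: "g \<le> r" using g by auto
      have "r choose 2 \<le> r choose g"
      proof (cases "2 * g \<le> r")
        case True
        then show ?thesis using g by (intro binomial_mono) auto
      next
        case False
        have "r choose 2 \<le> r choose (r - g)"
          using g False by (intro binomial_mono) auto
        also have "\<dots> = r choose g" using g by (intro binomial_symmetric[symmetric]) auto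
        finally show ?thesis .
      qed
      moreover have "real (r choose 2) = real r * real (r - 1) / 2"
      proof -
        have "even (r * (r - 1))" by (cases r) auto
        from real_of_nat_div[OF this] show ?thesis by (simp add: choose_two)
      qed
      ultimately have "real r * real (r - 1) / 2 \<le> real (r choose g)"
        by (metis of_nat_le_iff)
      hence "real r * real (r - 1) / 2 \<le> fact r / (fact g * fact (r - g))"
        using binomial_fact[OF gr, where 'a = real] by simp
      hence "fact g * fact (r - g) * (real r * real (r - 1)) \<le> 2 * fact r"
        by (simp add: field_simps)
      moreover have "real r * real (r - 1) > 0" using \<open>r \<ge> 3\<close> by simp
      ultimately show ?thesis by (simp only: pos_le_divide_eq)
    qed
    have "(\<Sum>g=2..<r-1. fact g * fact (r - g) :: real) \<le>
        real (card {2..<r-1}) * (2 * fact r / (real r * real (r - 1)))"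
      by (intro sum_bounded_above *)
    also have "\<dots> \<le> real (r - 1) * (2 * fact r / (real r * real (r - 1)))"
      by (intro mult_right_mono) auto
    also have "\<dots> = 2 * fact r / real r" using that by (simp add: field_simps)
    finally show ?thesis .
  qed
  have fr: "fact r / real r = fact (r - 1)" using assms by (cases r) auto
  consider "r = 1" | "r = 2" | "r \<ge> 3" using assms by linarith
  then show ?thesis
  proof cases
    case 3
    have "{1..<r} = insert 1 (insert (r - 1) {2..<r-1})" using 3 by auto
    hence "(\<Sum>g=1..<r. fact g * fact (r - g) :: real) =
        2 * fact (r - 1) + (\<Sum>g=2..<r-1. fact g * fact (r - g))" using 3 by simp
    with inner[OF 3] fr show ?thesis by simp
  next
    case 2
    have "{1..<2::nat} = {1}" by auto
    with 2 show ?thesis by simp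
  qed auto
qed

text \<open>The bound is proved by induction on \<open>m\<close> with the constant \<open>M\<close> replaced by the weight
  \<open>L ^ min r R\<close>: for \<open>r \<le> R\<close> the terms with \<open>g \<ge> 1\<close> gain a factor \<open>1 / L\<close>, and for
  \<open>r > R\<close> all of them but the last are small by the previous lemma.\<close>

lemma fact_conv_le:
  fixes \<delta> :: real
  assumes "\<delta> > 0"
  obtains M where "M \<ge> 1" "\<And>m r. fact_conv m r \<le> M * (1 + \<delta>) ^ m * fact r"
proof -
  \<comment> \<open>Relative to \<open>B r * fact r\<close>, for \<open>r \<le> R\<close> the terms
    with \<open>1 \<le> g < r\<close> cost at most \<open>4 / L\<close> and the term
    \<open>g = r\<close> at most \<open>1 / L\<close>; the total \<open>5 / L\<close> must not
    exceed \<delta>.\<close>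
  define L where "L = 1 + 5 / \<delta>"
  \<comment> \<open>Beyond \<open>R\<close> the terms with \<open>1 \<le> g < r\<close> have
    relative size \<open>4 / r \<le> \<delta> / 2\<close>; the other half of \<delta> is reserved
    for \<open>g = r\<close>.\<close>
  define R where "R = nat \<lceil>8 / \<delta>\<rceil>"
  \<comment> \<open>The value \<open>B 0 = 1\<close> matters: it reduces the term
    \<open>g = r\<close>, where the first gap takes everything, to \<open>fact r\<close>. With a
    constant weight this term would equal the one for \<open>g = 0\<close> and double the bound in
    each step.\<close>
  define B where "B r = L ^ min r R" for r
  have L: "L \<ge> 1" "5 \<le> \<delta> * L" using assms by (auto simp: L_def field_simps)
  have R: "8 / \<delta> \<le> real R" unfolding R_def by linarith
  have B: "B r \<ge> 1" for r using L by (simp add: B_def)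
  have main: "fact_conv m r \<le> B r * (1 + \<delta>) ^ m * fact r" for m r
  proof (induction m arbitrary: r)
    case 0
    then show ?case using B[of r] by (simp add: mult_left_le_one_le)
  next
    case (Suc m)
    have rest: "(\<Sum>g=1..r. fact g * (B (r - g) * fact (r - g))) \<le> \<delta> * B r * fact r"
    proof (cases "r = 0")
      case True
      then show ?thesis using assms B[of r] by auto
    next
      case False
      hence split: "(\<Sum>g=1..r. fact g * (B (r - g) * fact (r - g)) :: real) =
         (\<Sum>g=1..<r. B (r - g) * (fact g * fact (r - g))) + fact r"
        by (simp add: sum.last_plus[of 1 r] B_def mult_ac atLeastLessThanSuc_atLeastAtMost[symmetric])
      show ?thesis
      proof (cases "r \<le> R")
        case True
        have "(\<Sum>g=1..<r. B (r - g) * (fact g * fact (r - g))) \<le>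
           (\<Sum>g=1..<r. B r / L * (fact g * fact (r - g)))"
        proof (intro sum_mono mult_right_mono)
          fix g assume g: "g \<in> {1..<r}"
          have "B (r - g) = L ^ (r - g)" using True by (simp add: B_def min_def)
          also have "\<dots> \<le> L ^ (r - 1)" using g L by (intro power_increasing) auto
          also have "\<dots> = B r / L" using True False L by (cases r) (simp_all add: B_def min_def)
          finally show "B (r - g) \<le> B r / L" .
        qed auto
        also have "\<dots> = B r / L * (\<Sum>g=1..<r. fact g * fact (r - g))"
          by (simp add: sum_distrib_left)
        also have "\<dots> \<le> B r / L * (4 * fact r / real r)"
          using B[of r] L False by (intro mult_left_mono sum_fact_mult_fact_le) auto
        also have "\<dots> \<le> B r / L * (4 * fact r)"
          using B[of r] L False by (intro mult_left_mono) (auto simp: field_simps)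
        finally have "(\<Sum>g=1..<r. B (r - g) * (fact g * fact (r - g))) \<le> B r / L * (4 * fact r)" .
        moreover have "L \<le> B r"
          using True False L by (simp add: B_def min_def self_le_power)
        hence "fact r \<le> B r / L * fact r"
          using L by (simp add: field_simps)
        moreover have "B r / L * (4 * fact r) + B r / L * fact r = B r * fact r * (5 / L)"
          using L by (simp add: field_simps)
        ultimately have "(\<Sum>g=1..r. fact g * (B (r - g) * fact (r - g))) \<le> B r * fact r * (5 / L)"
          unfolding split by linarith
        also have "\<dots> \<le> B r * fact r * \<delta>"
          using L B[of r] by (intro mult_left_mono) (auto simp: field_simps)
        finally show ?thesis by (simp add: mult_ac)
      next
        case F: False
        have "(\<Sum>g=1..<r. B (r - g) * (fact g * fact (r - g))) \<le>
           (\<Sum>g=1..<r. B r * (fact g * fact (r - g)))"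
          using L by (intro sum_mono mult_right_mono) (auto simp: B_def intro!: power_increasing)
        also have "\<dots> = B r * (\<Sum>g=1..<r. fact g * fact (r - g))"
          by (simp add: sum_distrib_left)
        also have "\<dots> \<le> B r * (4 * fact r / real r)"
          using B[of r] L False by (intro mult_left_mono sum_fact_mult_fact_le) auto
        also have "\<dots> \<le> B r * (fact r * (\<delta> / 2))"
        proof -
          have "8 / \<delta> \<le> real r" using R F by linarith
          hence "4 / real r \<le> \<delta> / 2" using assms False by (simp add: field_simps)
          hence "fact r * (4 / real r) \<le> fact r * (\<delta> / 2)" by (intro mult_left_mono) auto
          thus ?thesis using B[of r] by (intro mult_left_mono) (auto simp: mult_ac)
        qed
        finally have "(\<Sum>g=1..<r. B (r - g) * (fact g * fact (r - g))) \<le> B r * (fact r * (\<delta> / 2))" .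
        moreover have "fact r \<le> B r * (fact r * (\<delta> / 2))"
        proof -
          have "0 < 8 / \<delta>" using assms by simp
          hence "R \<noteq> 0" using R by linarith
          hence "L \<le> B r" using F L by (simp add: B_def min_def self_le_power)
          moreover have "2 \<le> \<delta> * L" using L by linarith
          ultimately have "2 \<le> \<delta> * B r" using assms
            by (meson mult_left_mono less_eq_real_def order_trans)
          thus ?thesis by (simp add: field_simps)
        qed
        moreover have "B r * (fact r * (\<delta> / 2)) + B r * (fact r * (\<delta> / 2)) = \<delta> * B r * fact r"
          by (simp add: field_simps)
        ultimately show ?thesis unfolding split by linarith
      qed
    qed
    have "fact_conv (Suc m) r = (\<Sum>g\<le>r. fact g * fact_conv m (r - g))" by simp
    also have "\<dots> \<le> (\<Sum>g\<le>r. fact g * (B (r - g) * (1 + \<delta>) ^ m * fact (r - g)))"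
      by (intro sum_mono mult_left_mono Suc.IH) auto
    also have "\<dots> = (1 + \<delta>) ^ m * (\<Sum>g\<le>r. fact g * (B (r - g) * fact (r - g)))"
      by (simp add: sum_distrib_left mult_ac)
    also have "(\<Sum>g\<le>r. fact g * (B (r - g) * fact (r - g))) =
        B r * fact r + (\<Sum>g=1..r. fact g * (B (r - g) * fact (r - g)))"
      by (simp add: atMost_atLeast0 sum.atLeast_Suc_atMost)
    also have "(1 + \<delta>) ^ m * \<dots> \<le> (1 + \<delta>) ^ m * (B r * fact r + \<delta> * B r * fact r)"
      using rest assms by (intro mult_left_mono add_left_mono) auto
    also have "\<dots> = B r * (1 + \<delta>) ^ Suc m * fact r" by (simp add: algebra_simps)
    finally show ?case .
  qed
  have "fact_conv m r \<le> L ^ R * (1 + \<delta>) ^ m * fact r" for m r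
  proof -
    have "B r \<le> L ^ R" unfolding B_def using L by (intro power_increasing) auto
    hence "B r * (1 + \<delta>) ^ m * fact r \<le> L ^ R * (1 + \<delta>) ^ m * fact r"
      using assms by (intro mult_right_mono) auto
    with main[of m r] show ?thesis by linarith
  qed
  moreover have "L ^ R \<ge> 1" using L by simp
  ultimately show ?thesis using that by blast
qed

section \<open>Comparison of powers with factorials\<close>

lemma power_div_fact_le_exp: "x \<ge> 0 \<Longrightarrow> x ^ n / fact n \<le> exp (x :: real)"
proof -
  assume "x \<ge> 0"
  hence "(\<Sum>k\<in>{n}. x ^ k / fact k) \<le> (\<Sum>k. x ^ k / fact k)"
    using summable_exp[of x] by (intro sum_le_suminf) (auto simp: field_simps)
  thus ?thesis by (simp add: exp_def field_simps scaleR_conv_of_real)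
qed

text \<open>The number e of the thresholds enters the second moment here:
  \<open>(n / m) ^ m \<le> n choose m\<close> compares the two factorials up to the quotient of
  \<open>m ^ m\<close> and \<open>fact m\<close>, a single term of the series of
  \<open>exp m\<close>.\<close>

lemma power_mult_fact_diff_le:
  assumes "m \<le> n"
  shows "real n ^ m * fact (n - m) \<le> exp 1 ^ m * fact n"
proof (cases "m = 0")
  case False
  have "real n ^ m * fact (n - m) = (real n / real m) ^ m * real m ^ m * fact (n - m)"
    using False by (simp add: power_divide)
  also have "\<dots> \<le> real (n choose m) * real m ^ m * fact (n - m)"
    using binomial_ge_n_over_k_pow_k[of m n, where ?'a = real] assms
    by (intro mult_right_mono) auto
  also have "\<dots> = (real m ^ m / fact m) * fact n"
    using assms by (simp add: binomial_fact)
  also have "\<dots> \<le> exp (real m) * fact n"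
    by (intro mult_right_mono power_div_fact_le_exp) auto
  also have "exp (real m) = exp 1 ^ m" by (simp add: exp_of_nat_mult[symmetric])
  finally show ?thesis .
qed auto

text \<open>The ratio of the geometric sum collects e from the factorials, 1 + \<delta> from the
  gaps and 1 / \<gamma> from q = n / \<gamma>. As \<open>M\<close> is obtained before \<gamma>, it
  depends on \<delta> alone, so that \<gamma> may later vary with \<open>n\<close>.\<close>

lemma overlap_sum_le:
  fixes \<delta> :: real
  assumes "\<delta> > 0"
  obtains M where "M \<ge> 1"
    "\<And>n \<gamma>. \<gamma> > 0 \<Longrightarrow>
       overlap_sum (real n / \<gamma>) n / fact n \<le> 1 + M * (\<Sum>m=1..n. (exp 1 * (1 + \<delta>) / \<gamma>) ^ m)"
proof -
  obtain M where M: "M \<ge> 1" "\<And>m r. fact_conv m r \<le> M * (1 + \<delta>) ^ m * fact r"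
    using fact_conv_le[OF assms] by blast
  have "overlap_sum (real n / \<gamma>) n / fact n \<le> 1 + M * (\<Sum>m=1..n. (exp 1 * (1 + \<delta>) / \<gamma>) ^ m)"
    if "\<gamma> > 0" for n \<gamma>
  proof -
    have "overlap_sum (real n / \<gamma>) n =
       fact n + (\<Sum>m=1..n. (real n / \<gamma>) ^ m * fact_conv m (n - m))"
      by (simp add: overlap_sum_def atMost_atLeast0 sum.atLeast_Suc_atMost)
    also have "(\<Sum>m=1..n. (real n / \<gamma>) ^ m * fact_conv m (n - m)) \<le>
       (\<Sum>m=1..n. M * (exp 1 * (1 + \<delta>) / \<gamma>) ^ m * fact n)"
    proof (intro sum_mono)
      fix m assume m: "m \<in> {1..n}"
      have "(real n / \<gamma>) ^ m * fact_conv m (n - m) \<le>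
        (real n / \<gamma>) ^ m * (M * (1 + \<delta>) ^ m * fact (n - m))"
        using that by (intro mult_left_mono M) auto
      also have "\<dots> = (real n ^ m * fact (n - m)) * (M * ((1 + \<delta>) / \<gamma>) ^ m)"
        by (simp add: power_divide field_simps)
      also have "\<dots> \<le> (exp 1 ^ m * fact n) * (M * ((1 + \<delta>) / \<gamma>) ^ m)"
        using m M assms that by (intro mult_right_mono power_mult_fact_diff_le) auto
      also have "\<dots> = M * (exp 1 * (1 + \<delta>) / \<gamma>) ^ m * fact n"
        by (simp add: power_divide power_mult_distrib mult_ac)
      finally show "(real n / \<gamma>) ^ m * fact_conv m (n - m) \<le> M * (exp 1 * (1 + \<delta>) / \<gamma>) ^ m * fact n" .
    qed
    finally show ?thesis
      by (simp add: field_simps sum_distrib_left)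
  qed
  with M(1) that show ?thesis by blast
qed

text \<open>The induction step amounts to e x ^ (n + 1) \<le> (x + 1) ^ (n + 1) for x = n, which is
  1 + y \<le> exp y at y = - 1 / (x + 1). The factor n in place of its square root is affordable,
  since the bound only competes with geometric decay.\<close>

lemma fact_le_stirling:
  assumes "n \<ge> 1"
  shows "fact n \<le> exp 1 * real n * (real n / exp 1) ^ n"
  using assms
proof (induction n rule: dec_induct)
  case base
  then show ?case by simp
next
  case (step n)
  define x where "x = real n"
  have x: "x \<ge> 1" using step by (simp add: x_def)
  have "exp 1 * x ^ Suc n \<le> (x + 1) ^ Suc n"
  proof -
    have "1 + - (1 / (x + 1)) \<le> exp (- (1 / (x + 1)))" by (rule exp_ge_add_one_self)
    hence "x / (x + 1) \<le> exp (- (1 / (x + 1)))" using x by (simp add: field_simps)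
    hence "(x / (x + 1)) ^ Suc n \<le> exp (- (1 / (x + 1))) ^ Suc n"
      using x by (intro power_mono) auto
    also have "\<dots> = exp (- 1)"
      using x by (subst exp_of_nat_mult[symmetric]) (simp add: x_def field_simps)
    finally have "x ^ Suc n / (x + 1) ^ Suc n \<le> inverse (exp 1)"
      by (simp only: power_divide exp_minus)
    thus ?thesis using x by (simp add: field_simps del: power_Suc)
  qed
  hence *: "exp 1 * x ^ Suc n / exp 1 ^ n \<le> (x + 1) ^ Suc n / exp 1 ^ n"
    by (intro divide_right_mono) auto
  have "fact (Suc n) = (x + 1) * fact n" by (simp add: x_def)
  also have "\<dots> \<le> (x + 1) * (exp 1 * x * (x / exp 1) ^ n)"
    using step x by (intro mult_left_mono) (auto simp: x_def)
  also have "\<dots> = (x + 1) * (exp 1 * x ^ Suc n / exp 1 ^ n)"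
    by (simp add: power_divide)
  also have "\<dots> \<le> (x + 1) * ((x + 1) ^ Suc n / exp 1 ^ n)"
    using * x by (intro mult_left_mono) auto
  also have "\<dots> = exp 1 * (x + 1) * ((x + 1) / exp 1) ^ Suc n"
    by (simp add: power_divide)
  finally show ?case by (simp add: x_def add_ac)
qed

section \<open>Common steps of two permutations\<close>

text \<open>The lists give the order in which coordinates are flipped. A vertex depends only on the
  set of coordinates flipped so far, so these are the times at which two walks from the same vertex
  use the same edge, whatever the orders inside the prefixes.\<close>

definition common_steps :: "'a list \<Rightarrow> 'a list \<Rightarrow> nat set" where
  "common_steps s t =
     {k. k < length s \<and> k < length t \<and> set (take k s) = set (take k t) \<and> s ! k = t ! k}"

lemma finite_common_steps [simp]: "finite (common_steps s t)"
  by (simp add: common_steps_def)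

text \<open>Expand (1 + (q - 1)) ^ card C over the subsets of \<open>C\<close> and group the
  nonempty ones by their least element \<open>k\<close>: those with least element \<open>k\<close>
  add up to q - 1 times the power of \<open>q\<close> for the later elements.\<close>

lemma power_card_eq:
  fixes q :: real and C :: "nat set"
  assumes "finite C"
  shows "q ^ card C = 1 + (q - 1) * (\<Sum>k\<in>C. q ^ card {j\<in>C. k < j})"
  using assms
proof (induction C rule: finite_linorder_min_induct)
  case empty
  then show ?case by simp
next
  case (insert b A)
  have b: "b \<notin> A" using insert by blast
  have "{j \<in> insert b A. b < j} = A" using insert by auto
  moreover have "{j \<in> insert b A. k < j} = {j \<in> A. k < j}" if "k \<in> A" for k
    using insert that by auto
  ultimately have *: "(\<Sum>k\<in>insert b A. q ^ card {j\<in>insert b A. k < j}) =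
      q ^ card A + (\<Sum>k\<in>A. q ^ card {j\<in>A. k < j})"
    using insert.hyps(1) b by simp
  have "q ^ card (insert b A) = q * q ^ card A" using insert.hyps(1) b by simp
  thus ?case unfolding * using insert.IH by (simp add: algebra_simps)
qed

text \<open>The coefficient q - 1 is enlarged to q to match the recursion of
  \<open>overlap_sum\<close>; exchanging the sums makes the position \<open>k\<close> the outer
  index.\<close>

lemma sum_power_card_le:
  fixes q :: real and C :: "'a \<Rightarrow> nat set"
  assumes "q \<ge> 1" "finite P" "\<And>t. t \<in> P \<Longrightarrow> C t \<subseteq> {..<n}"
  shows "(\<Sum>t\<in>P. q ^ card (C t)) \<le>
    real (card P) + q * (\<Sum>k<n. \<Sum>t | t \<in> P \<and> k \<in> C t. q ^ card {j\<in>C t. k < j})"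
proof -
  have "(\<Sum>t\<in>P. q ^ card (C t)) \<le>
      (\<Sum>t\<in>P. 1 + q * (\<Sum>k | k \<in> {..<n} \<and> k \<in> C t. q ^ card {j\<in>C t. k < j}))"
  proof (rule sum_mono)
    fix t assume t: "t \<in> P"
    have C: "{k. k \<in> {..<n} \<and> k \<in> C t} = C t" using assms(3)[OF t] by auto
    have "finite (C t)" using assms(3)[OF t] finite_subset by blast
    then show "q ^ card (C t) \<le>
        1 + q * (\<Sum>k | k \<in> {..<n} \<and> k \<in> C t. q ^ card {j\<in>C t. k < j})"
      unfolding C power_card_eq[OF \<open>finite (C t)\<close>, of q] using assms(1)
      by (intro add_left_mono mult_right_mono sum_nonneg) auto
  qed
  also have "\<dots> = real (card P) +
      q * (\<Sum>t\<in>P. \<Sum>k | k \<in> {..<n} \<and> k \<in> C t. q ^ card {j\<in>C t. k < j})"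
    by (simp add: sum.distrib sum_distrib_left)
  also have "(\<Sum>t\<in>P. \<Sum>k | k \<in> {..<n} \<and> k \<in> C t. q ^ card {j\<in>C t. k < j}) =
      (\<Sum>k<n. \<Sum>t | t \<in> P \<and> k \<in> C t. q ^ card {j\<in>C t. k < j})"
    using assms(2) by (intro sum.swap_restrict) auto
  finally show ?thesis .
qed

lemma set_take_drop_eq:
  "distinct s \<Longrightarrow> set (take i (drop k s)) = set (take (i + k) s) - set (take k s)"
proof -
  assume d: "distinct s"
  have "take (i + k) s = take k s @ take i (drop k s)"
    by (metis add.commute take_add)
  moreover have "set (take k s) \<inter> set (take i (drop k s)) = {}"
    using set_take_disj_set_drop_if_distinct[OF d, of k k] set_take_subset by fastforce
  ultimately show ?thesis by auto
qed

lemma set_take_Suc: "k < length s \<Longrightarrow> set (take (Suc k) s) = insert (s ! k) (set (take k s))"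
  by (simp add: take_Suc_conv_app_nth)

lemma nth_notin_set_take: "distinct s \<Longrightarrow> k < length s \<Longrightarrow> s ! k \<notin> set (take k s)"
  by (auto simp: in_set_conv_nth nth_eq_iff_index_eq)

lemma card_set_take: "distinct s \<Longrightarrow> k \<le> length s \<Longrightarrow> card (set (take k s)) = k"
  by (simp add: distinct_card)

text \<open>After a common step both lists have used up the same \<open>Suc k\<close> elements, so
  prefix sets of the tails agree whenever the corresponding longer prefix sets do.\<close>

lemma common_steps_drop:
  assumes "distinct s" "distinct t" "k \<in> common_steps s t"
  shows "{j \<in> common_steps s t. k < j} \<subseteq>
     (\<lambda>i. i + Suc k) ` common_steps (drop (Suc k) s) (drop (Suc k) t)"
proof
  fix j assume "j \<in> {j \<in> common_steps s t. k < j}"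
  hence j: "j \<in> common_steps s t" "k < j" by auto
  define i where "i = j - Suc k"
  have ij: "j = i + Suc k" using j by (simp add: i_def)
  have "set (take (Suc k) s) = set (take (Suc k) t)"
    using assms(3) by (simp add: common_steps_def set_take_Suc)
  hence "i \<in> common_steps (drop (Suc k) s) (drop (Suc k) t)"
    using j(1) unfolding ij
    by (auto simp: common_steps_def set_take_drop_eq[OF assms(1)] set_take_drop_eq[OF assms(2)]
        add.commute)
  thus "j \<in> (\<lambda>i. i + Suc k) ` common_steps (drop (Suc k) s) (drop (Suc k) t)"
    unfolding ij by blast
qed

lemma card_common_steps_drop:
  assumes "distinct s" "distinct t" "k \<in> common_steps s t"
  shows "card {j \<in> common_steps s t. k < j} \<le>
     card (common_steps (drop (Suc k) s) (drop (Suc k) t))"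
  by (rule order_trans[OF card_mono[OF _ common_steps_drop[OF assms]]])
     (auto intro: card_image_le)

text \<open>A common step \<open>k\<close> cuts \<open>t\<close> into a permutation of \<open>take k s\<close>, the step itself, and the
  remaining steps, which with \<open>take l t\<close> form a permutation of \<open>B - set (take (Suc k) s)\<close>.\<close>

lemma sum_power_common_steps_le:
  fixes q :: real
  assumes "q \<ge> 1" "finite B" "distinct s" "set s \<subseteq> B"
  shows "(\<Sum>t\<in>permutations_of_set B. q ^ card (common_steps s (drop l t))) \<le> overlap_sum q (card B)"
  using assms(2-4)
\<comment> \<open>Here \<open>l\<close> stays fixed, while \<open>s\<close> shrinks to a tail and
  \<open>B\<close> loses the used elements. The first \<open>l\<close> entries of \<open>t\<close>
  are steps made before the walks meet; \<open>l = 0\<close> is the case of a common start.\<close>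
proof (induction "length s" arbitrary: s B rule: less_induct)
  case less
  define b where "b = card B"
  define P where "P = permutations_of_set B"
  have len_s: "length s \<le> b"
    using less.prems by (metis b_def card_mono distinct_card)
  have P: "distinct t" "set t = B" "length t = b" if "t \<in> P" for t
    using that by (auto simp: P_def b_def permutations_of_setD length_finite_permutations_of_set)
  have step: "(\<Sum>t | t \<in> P \<and> k \<in> common_steps s (drop l t).
        q ^ card {j \<in> common_steps s (drop l t). k < j}) \<le> fact k * overlap_sum q (b - Suc k)"
    if k: "k < length s" for k
  proof -
    define B' where "B' = B - set (take (Suc k) s)"
    define Pk where "Pk = {t. t \<in> P \<and> k \<in> common_steps s (drop l t)}"
    define h where "h t = (take k (drop l t), take l t @ drop (l + Suc k) t)" for t :: "'a list"
    have cB': "card B' = b - Suc k"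
      using less.prems k card_set_take[of s "Suc k"] set_take_subset[of "Suc k" s]
      by (simp add: B'_def b_def card_Diff_subset)
    have Pk: "l + k < length t" "t ! (l + k) = s ! k" "set (take k (drop l t)) = set (take k s)"
      if "t \<in> Pk" for t
      using that by (auto simp: Pk_def common_steps_def)
    have decomp: "t = take l t @ take k (drop l t) @ s ! k # drop (l + Suc k) t" if "t \<in> Pk" for t
    proof -
      have "t = take l t @ take k (drop l t) @ drop k (drop l t)"
        by (metis append_take_drop_id)
      also have "drop k (drop l t) = s ! k # drop (l + Suc k) t"
        using Pk[OF that] Cons_nth_drop_Suc[of "l + k" t] by (simp add: add.commute)
      finally show ?thesis .
    qed
    have inj: "inj_on h Pk"
    proof (rule inj_onI)
      fix t u assume t: "t \<in> Pk" and u: "u \<in> Pk" and hh: "h t = h u"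
      have "length (take l t) = length (take l u)" using Pk(1)[OF t] Pk(1)[OF u] by simp
      with hh have "take l t = take l u" "drop (l + Suc k) t = drop (l + Suc k) u"
          "take k (drop l t) = take k (drop l u)"
        by (auto simp: h_def)
      thus "t = u" using decomp[OF t] decomp[OF u] by metis
    qed
    have range: "h ` Pk \<subseteq> permutations_of_set (set (take k s)) \<times> permutations_of_set B'"
    proof
      fix z assume "z \<in> h ` Pk"
      then obtain t where t: "t \<in> Pk" and z: "z = h t" by blast
      have dt: "distinct t" "set t = B" using P t by (auto simp: Pk_def)
      define a where "a = take l t"
      define m where "m = take k (drop l t)"
      define c where "c = drop (l + Suc k) t"
      have teq: "t = a @ m @ s ! k # c" unfolding a_def m_def c_def by (rule decomp[OF t])
      have "set m = set (take k s)" unfolding m_def by (rule Pk(3)[OF t])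
      moreover have "distinct m" "distinct (a @ c)" using dt(1) unfolding teq by auto
      moreover have "set (a @ c) = B'"
        unfolding B'_def set_take_Suc[OF k] dt(2)[symmetric] \<open>set m = set (take k s)\<close>[symmetric]
        using dt(1) unfolding teq by auto
      ultimately show "z \<in> permutations_of_set (set (take k s)) \<times> permutations_of_set B'"
        unfolding z h_def a_def[symmetric] m_def[symmetric] c_def[symmetric] by auto
    qed
    define g where "g z = q ^ card (common_steps (drop (Suc k) s) (drop l (snd z)))"
      for z :: "'a list \<times> 'a list"
    have "(\<Sum>t\<in>Pk. q ^ card {j \<in> common_steps s (drop l t). k < j}) \<le> (\<Sum>t\<in>Pk. g (h t))"
    proof (rule sum_mono)
      fix t assume t: "t \<in> Pk"
      have "drop l (snd (h t)) = drop (Suc k) (drop l t)"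
        using Pk(1)[OF t] by (simp add: h_def add.commute)
      hence "g (h t) = q ^ card (common_steps (drop (Suc k) s) (drop (Suc k) (drop l t)))"
        by (simp add: g_def)
      moreover have "card {j \<in> common_steps s (drop l t). k < j} \<le>
          card (common_steps (drop (Suc k) s) (drop (Suc k) (drop l t)))"
        using t P less.prems by (intro card_common_steps_drop) (auto simp: Pk_def)
      ultimately show "q ^ card {j \<in> common_steps s (drop l t). k < j} \<le> g (h t)"
        using assms(1) by (simp add: power_increasing)
    qed
    also have "\<dots> = (\<Sum>z\<in>h ` Pk. g z)" by (simp add: sum.reindex[OF inj])
    also have "\<dots> \<le> (\<Sum>z\<in>permutations_of_set (set (take k s)) \<times> permutations_of_set B'. g z)"
      using assms(1) by (intro sum_mono2 range) (auto simp: g_def)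
    also have "\<dots> = fact k *
        (\<Sum>t\<in>permutations_of_set B'. q ^ card (common_steps (drop (Suc k) s) (drop l t)))"
      using card_set_take[of s k] less.prems k
      by (simp add: g_def sum.cartesian_product')
    also have "\<dots> \<le> fact k * overlap_sum q (card B')"
    proof (intro mult_left_mono less.hyps)
      show "set (drop (Suc k) s) \<subseteq> B'"
        using less.prems set_drop_subset[of "Suc k" s]
          set_take_disj_set_drop_if_distinct[of s "Suc k" "Suc k"] by (auto simp: B'_def)
    qed (use less.prems k in \<open>auto simp: B'_def\<close>)
    finally show ?thesis by (simp add: cB' Pk_def)
  qed
  have "(\<Sum>t\<in>P. q ^ card (common_steps s (drop l t))) \<le>
     real (card P) + q * (\<Sum>k<length s. \<Sum>t | t \<in> P \<and> k \<in> common_steps s (drop l t).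
        q ^ card {j \<in> common_steps s (drop l t). k < j})"
    using assms(1) by (intro sum_power_card_le) (auto simp: P_def common_steps_def)
  also have "\<dots> \<le> real (card P) + q * (\<Sum>k<length s. fact k * overlap_sum q (b - Suc k))"
    using assms(1) step by (intro add_left_mono mult_left_mono sum_mono) auto
  \<comment> \<open>Since \<open>s\<close> may be shorter than \<open>b\<close>, nonnegative terms
    are added to complete the sum in the recursion.\<close>
  also have "\<dots> \<le> real (card P) + q * (\<Sum>k<b. fact k * overlap_sum q (b - Suc k))"
    using assms(1) len_s
    by (intro add_left_mono mult_left_mono sum_mono2) (auto intro!: mult_nonneg_nonneg overlap_sum_nonneg)
  also have "real (card P) = fact b"
    using less.prems by (simp add: P_def b_def)
  also have "fact b + q * (\<Sum>k<b. fact k * overlap_sum q (b - Suc k)) = overlap_sum q b"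
    by (rule overlap_sum_rec[symmetric])
  finally show ?case by (simp add: P_def b_def)
qed

section \<open>Diameter paths as walks\<close>

definition flip :: "vertex \<Rightarrow> nat set \<Rightarrow> vertex" where
  "flip y A = map (\<lambda>i. (y ! i) \<noteq> (i \<in> A)) [0..<length y]"

text \<open>A geodesic is encoded by its start and the order of its flips. Equality of vertices on
  walks from one start then becomes equality of prefix sets.\<close>

definition walk :: "vertex \<Rightarrow> nat list \<Rightarrow> vertex list" where
  "walk y t = map (\<lambda>k. flip y (set (take k t))) [0..<Suc (length t)]"

definition walk_edge :: "vertex \<Rightarrow> nat list \<Rightarrow> nat \<Rightarrow> edge" where
  "walk_edge y t k = {flip y (set (take k t)), flip y (set (take (Suc k) t))}"

definition walk_edges :: "vertex \<Rightarrow> nat list \<Rightarrow> edge set" where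
  "walk_edges y t = walk_edge y t ` {..<length t}"

lemma length_flip [simp]: "length (flip y A) = length y"
  by (simp add: flip_def)

lemma nth_flip [simp]: "i < length y \<Longrightarrow> flip y A ! i \<longleftrightarrow> (y ! i) \<noteq> (i \<in> A)"
  by (simp add: flip_def)

lemma flip_empty [simp]: "flip y {} = y"
  by (simp add: flip_def map_nth)

lemma flip_UNIV: "{..<length y} \<subseteq> A \<Longrightarrow> flip y A = map Not y"
  by (rule nth_equalityI) auto

lemma flip_flip: "flip (flip y A) B = flip y ((A - B) \<union> (B - A))"
  by (rule nth_equalityI) auto

lemma flip_eq_iff:
  assumes "A \<subseteq> {..<length y}" "B \<subseteq> {..<length y}"
  shows "flip y A = flip y B \<longleftrightarrow> A = B"
proof
  assume *: "flip y A = flip y B"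
  have "i \<in> A \<longleftrightarrow> i \<in> B" if "i < length y" for i
    using arg_cong[OF *, of "\<lambda>z. z ! i"] that by auto
  thus "A = B" using assms by auto
qed simp

lemma flip_mono_forward: "A \<subseteq> B \<Longrightarrow> flip y B = flip (flip y A) (B - A)"
  by (simp add: flip_flip) (rule arg_cong[of _ _ "flip y"], auto)

lemma flip_mono_backward: "A \<subseteq> B \<Longrightarrow> flip y A = flip (flip y B) (B - A)"
  by (simp add: flip_flip) (rule arg_cong[of _ _ "flip y"], auto)

lemma length_walk [simp]: "length (walk y t) = Suc (length t)"
  by (simp add: walk_def)

lemma nth_walk: "k \<le> length t \<Longrightarrow> walk y t ! k = flip y (set (take k t))"
  by (simp add: walk_def del: upt_Suc)

lemma hd_walk [simp]: "hd (walk y t) = y"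
  by (simp add: walk_def hd_map del: upt_Suc)

lemma path_edges_walk: "path_edges {walk y t, rev (walk y t)} = walk_edges y t"
proof -
  have *: "{{rev xs ! i, rev xs ! Suc i} | i. Suc i < length xs} =
      {{xs ! i, xs ! Suc i} | i. Suc i < length xs}" for xs :: "vertex list"
  proof -
    have "\<exists>j. {rev xs ! i, rev xs ! Suc i} = {xs ! j, xs ! Suc j} \<and> Suc j < length xs"
      if "Suc i < length xs" for i and xs :: "vertex list"
    proof (intro exI conjI)
      show "{rev xs ! i, rev xs ! Suc i} = {xs ! (length xs - Suc (Suc i)), xs ! Suc (length xs - Suc (Suc i))}"
        using that by (auto simp: rev_nth Suc_diff_Suc)
    qed (use that in auto)
    from this[of _ xs] this[of _ "rev xs"] show ?thesis by fastforce
  qed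
  have "path_edges {walk y t, rev (walk y t)} =
     {{walk y t ! i, walk y t ! Suc i} | i. Suc i < length (walk y t)}"
    using *[of "walk y t"] by (simp add: path_edges_def)
  also have "\<dots> = (\<lambda>k. {walk y t ! k, walk y t ! Suc k}) ` {..<length t}"
    by auto
  also have "\<dots> = walk_edges y t"
    unfolding walk_edges_def by (rule image_cong) (auto simp: walk_edge_def nth_walk)
  finally show ?thesis .
qed

text \<open>The number of flipped coordinates is the distance from the start, so a shared edge is
  passed at the same time and away from the start by both walks. The opposite orientation would
  require both k = l + 1 and k + 1 = l.\<close>

lemma walk_edge_same_start:
  assumes "set s \<subseteq> {..<length y}" "set t \<subseteq> {..<length y}" "distinct s" "distinct t"
    and k: "k < length s" and l: "l < length t" and e: "walk_edge y s k = walk_edge y t l"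
  shows "l = k" "k \<in> common_steps s t"
proof -
  have sub: "set (take i s) \<subseteq> {..<length y}" "set (take i t) \<subseteq> {..<length y}" for i
    using assms(1,2) set_take_subset by fast+
  note inj = flip_eq_iff[OF sub(1) sub(2)]
  have c: "card (set (take k s)) = k" "card (set (take (Suc k) s)) = Suc k"
     "card (set (take l t)) = l" "card (set (take (Suc l) t)) = Suc l"
    using assms by (simp_all only: card_set_take Suc_leI less_imp_le)
  from e consider
      "set (take k s) = set (take l t)" "set (take (Suc k) s) = set (take (Suc l) t)"
    | "set (take k s) = set (take (Suc l) t)" "set (take (Suc k) s) = set (take l t)"
    unfolding walk_edge_def doubleton_eq_iff inj by blast
  hence "l = k \<and> k \<in> common_steps s t"
  proof cases
    case 1
    hence lk: "l = k" using c by metis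
    have "s ! k = t ! k"
      using 1 nth_notin_set_take[of s k] nth_notin_set_take[of t k] assms unfolding lk
      by (auto simp: set_take_Suc)
    thus ?thesis using 1 lk k l by (simp add: common_steps_def)
  next
    case 2
    hence False using c by (metis n_not_Suc_n Suc_n_not_le_n le_refl lessI less_SucI nat_neq_iff)
    thus ?thesis ..
  qed
  thus "l = k" "k \<in> common_steps s t" by auto
qed

lemma walk_edge_inj:
  assumes "set t \<subseteq> {..<length y}" "distinct t"
  shows "inj_on (walk_edge y t) {..<length t}"
  using walk_edge_same_start(1)[OF assms(1) assms(1) assms(2) assms(2)]
  by (auto simp: inj_on_def)

lemma card_walk_edges:
  assumes "set t \<subseteq> {..<length y}" "distinct t"
  shows "card (walk_edges y t) = length t"
  by (simp add: walk_edges_def card_image walk_edge_inj[OF assms])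

lemma card_walk_edges_Int_same_start:
  assumes "set s \<subseteq> {..<length y}" "set t \<subseteq> {..<length y}" "distinct s" "distinct t"
  shows "card (walk_edges y s \<inter> walk_edges y t) \<le> card (common_steps s t)"
proof -
  have "walk_edges y s \<inter> walk_edges y t \<subseteq> walk_edge y s ` common_steps s t"
    using walk_edge_same_start(2)[OF assms] by (fastforce simp: walk_edges_def)
  hence "card (walk_edges y s \<inter> walk_edges y t) \<le> card (walk_edge y s ` common_steps s t)"
    by (intro card_mono) auto
  also have "\<dots> \<le> card (common_steps s t)" by (rule card_image_le) simp
  finally show ?thesis .
qed

section \<open>Common edges of geodesics with different starting points\<close>

definition steps_on :: "vertex \<Rightarrow> nat list \<Rightarrow> vertex \<Rightarrow> nat list \<Rightarrow> nat set" where
  "steps_on x s y t = {k. k < length s \<and> walk_edge x s k \<in> walk_edges y t}"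

lemma finite_steps_on [simp]: "finite (steps_on x s y t)"
  by (simp add: steps_on_def)

lemma card_walk_edges_Int_le: "card (walk_edges x s \<inter> walk_edges y t) \<le> card (steps_on x s y t)"
proof -
  have "walk_edges x s \<inter> walk_edges y t \<subseteq> walk_edge x s ` steps_on x s y t"
    by (auto simp: walk_edges_def steps_on_def)
  hence "card (walk_edges x s \<inter> walk_edges y t) \<le> card (walk_edge x s ` steps_on x s y t)"
    by (intro card_mono) auto
  also have "\<dots> \<le> card (steps_on x s y t)" by (rule card_image_le) simp
  finally show ?thesis .
qed

lemma flip_take_drop:
  assumes "distinct s"
  shows "flip (flip y (set (take k s))) (set (take i (drop k s))) = flip y (set (take (i + k) s))"
  unfolding set_take_drop_eq[OF assms]
  by (rule flip_mono_forward[symmetric]) (simp add: set_take_subset_set_take)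

lemma walk_edge_drop:
  assumes "distinct s"
  shows "walk_edge y s (i + k) = walk_edge (flip y (set (take k s))) (drop k s) i"
  unfolding walk_edge_def flip_take_drop[OF assms] by simp

text \<open>Once two geodesics run through the same oriented edge, the common edges that come later on
  one of them also come later on the other: the earlier vertices of the second one differ from the
  head of that edge in the direction of that edge.\<close>

lemma card_steps_on_after:
  assumes s: "set s \<subseteq> {..<length x}" "distinct s" and t: "set t \<subseteq> {..<length x}" "distinct t"
    and len: "length y = length x" and k: "k < length s" and l: "l < length t"
    and e: "flip x (set (take k s)) = flip y (set (take l t))"
    and e': "flip x (set (take (Suc k) s)) = flip y (set (take (Suc l) t))"
  shows "s ! k = t ! l"
    and "card {j \<in> steps_on x s y t. k < j} \<le>
           card (common_steps (drop (Suc k) s) (drop (Suc l) t))"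
proof -
  define z where "z = flip x (set (take (Suc k) s))"
  define s' where "s' = drop (Suc k) s"
  define t' where "t' = drop (Suc l) t"
  have len_z: "length z = length x" by (simp add: z_def)
  have sub: "set s' \<subseteq> {..<length z}" "set t' \<subseteq> {..<length z}"
    using s t set_drop_subset[of "Suc k" s] set_drop_subset[of "Suc l" t] len
    by (auto simp: s'_def t'_def z_def)
  have d: "distinct s'" "distinct t'" using s t by (simp_all add: s'_def t'_def)
  have sk: "s ! k < length x" "t ! l < length x" using s t k l by (auto simp: subset_iff)
  have before: "flip y (set (take i t)) = flip z (set (take (Suc l) t) - set (take i t))"
    if "i \<le> Suc l" for i
    unfolding z_def e' using that
    by (intro flip_mono_backward) (simp add: set_take_subset_set_take)
  have "flip x (set (take k s)) = flip z (set (take (Suc k) s) - set (take k s))"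
    unfolding z_def by (intro flip_mono_backward) (simp add: set_take_subset_set_take)
  also have "set (take (Suc k) s) - set (take k s) = {s ! k}"
    using k s nth_notin_set_take[of s k] by (auto simp: set_take_Suc)
  finally have "flip x (set (take k s)) = flip z {s ! k}" .
  moreover have "set (take (Suc l) t) - set (take l t) = {t ! l}"
    using l t nth_notin_set_take[of t l] by (auto simp: set_take_Suc)
  hence "flip y (set (take l t)) = flip z {t ! l}" using before[of l] by simp
  ultimately have "flip z {s ! k} = flip z {t ! l}" using e by simp
  thus st: "s ! k = t ! l" using sk by (subst (asm) flip_eq_iff) (auto simp: len_z)
  have "{j \<in> steps_on x s y t. k < j} \<subseteq> (\<lambda>i. i + Suc k) ` common_steps s' t'"
  proof
    fix j assume "j \<in> {j \<in> steps_on x s y t. k < j}"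
    then obtain i where kj: "k < j" "j < length s" and i: "i < length t"
        and eq: "walk_edge x s j = walk_edge y t i"
      by (auto simp: steps_on_def walk_edges_def)
    define j' where "j' = j - Suc k"
    have j': "j = j' + Suc k" using kj by (simp add: j'_def)
    have wj: "walk_edge x s j = walk_edge z s' j'"
      unfolding j' walk_edge_drop[OF s(2)] z_def s'_def ..
    have "j' \<in> common_steps s' t'"
    proof (cases "l < i")
      case True
      define i' where "i' = i - Suc l"
      have i': "i = i' + Suc l" using True by (simp add: i'_def)
      have "walk_edge y t i = walk_edge z t' i'"
        unfolding i' walk_edge_drop[OF t(2)] z_def t'_def e' ..
      with eq wj have "walk_edge z s' j' = walk_edge z t' i'" by simp
      moreover have "j' < length s'" "i' < length t'"
        using kj i unfolding j' i' by (auto simp: s'_def t'_def)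
      ultimately show ?thesis using sub d by (intro walk_edge_same_start(2)[of s' z t' j' i'])
    next
      case False
      \<comment> \<open>The earlier endpoint of the \<open>i\<close>-th edge has to be taken: for
        \<open>i = l\<close> the later one is \<open>z\<close> itself and gives no
        contradiction.\<close>
      have "flip y (set (take i t)) \<in> walk_edge z s' j'"
        using eq wj by (auto simp: walk_edge_def)
      then obtain m where "flip y (set (take i t)) = flip z (set (take m s'))"
        by (auto simp: walk_edge_def)
      hence "flip z (set (take (Suc l) t) - set (take i t)) = flip z (set (take m s'))"
        using before[of i] False by simp
      hence "set (take (Suc l) t) - set (take i t) = set (take m s')"
        using t sub set_take_subset[of "Suc l" t] set_take_subset[of m s']
        by (subst (asm) flip_eq_iff) (auto simp: len_z)
      moreover have "t ! l \<notin> set (take i t)"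
        using nth_notin_set_take[OF t(2) l] False set_take_subset_set_take[of i l t] by auto
      hence "t ! l \<in> set (take (Suc l) t) - set (take i t)"
        using l by (simp add: set_take_Suc)
      moreover have "s ! k \<notin> set s'"
        using s k by (simp add: s'_def set_take_Suc Cons_nth_drop_Suc[symmetric]
           disjoint_iff)
          (metis Cons_nth_drop_Suc distinct.simps(2) distinct_drop)
      ultimately have False using st set_take_subset[of m s'] by auto
      thus ?thesis ..
    qed
    thus "j \<in> (\<lambda>i. i + Suc k) ` common_steps s' t'" unfolding j' by blast
  qed
  hence "card {j \<in> steps_on x s y t. k < j} \<le> card ((\<lambda>i. i + Suc k) ` common_steps s' t')"
    by (intro card_mono) auto
  also have "\<dots> \<le> card (common_steps s' t')" by (rule card_image_le) simp
  finally show "card {j \<in> steps_on x s y t. k < j} \<le>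
     card (common_steps (drop (Suc k) s) (drop (Suc l) t))" by (simp add: s'_def t'_def)
qed

section \<open>Reversal of geodesics\<close>

lemma flip_Not: "flip (map Not y) A = flip y (- A)"
  by (rule nth_equalityI) auto

text \<open>Starting at the antipode means that all coordinates are flipped already; flipping those
  of a suffix of \<open>t\<close> back leaves exactly the prefix flipped.\<close>

lemma flip_rev:
  assumes "set t = {..<length y}" "distinct t" "k \<le> length t"
  shows "flip (map Not y) (set (take k (rev t))) = flip y (set (take (length t - k) t))"
proof -
  have "set (take k (rev t)) = set (drop (length t - k) t)"
    by (simp add: take_rev)
  also have "\<dots> = {..<length y} - set (take (length t - k) t)"
    using set_take_drop_eq[of t k "length t - k"] assms by simp
  finally show ?thesis
    unfolding flip_Not by (intro nth_equalityI) auto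
qed

lemma walk_rev:
  assumes "set t = {..<length y}" "distinct t"
  shows "walk (map Not y) (rev t) = rev (walk y t)"
  using assms by (intro nth_equalityI) (auto simp: nth_walk rev_nth flip_rev)

lemma walk_edges_rev:
  assumes "set t = {..<length y}" "distinct t"
  shows "walk_edges (map Not y) (rev t) = walk_edges y t"
  unfolding path_edges_walk[symmetric] walk_rev[OF assms] by (simp add: insert_commute)

section \<open>Oriented diameter paths correspond to walks along permutations\<close>

lemma permutations_lessThanD:
  assumes "t \<in> permutations_of_set {..<n}"
  shows "set t = {..<n}" "distinct t" "length t = n"
  using permutations_of_setD[OF assms] length_finite_permutations_of_set[OF assms] by auto

lemma hc_verticesD: "y \<in> hc_vertices n \<Longrightarrow> length y = n"
  by (simp add: hc_vertices_def)

lemma card_hc_vertices: "card (hc_vertices n) = 2 ^ n"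
  using card_lists_length_eq[of "UNIV :: bool set" n] by (simp add: hc_vertices_def)

lemma walk_edge_in_hc_edges:
  assumes y: "y \<in> hc_vertices n" and t: "t \<in> permutations_of_set {..<n}" and i: "i < n"
  shows "walk_edge y t i \<in> hc_edges n"
proof -
  note tD = permutations_lessThanD[OF t] and ly = hc_verticesD[OF y]
  have "t ! i < n" using tD i by (metis lessThan_iff nth_mem)
  moreover have "t ! i \<notin> set (take i t)" using tD i by (intro nth_notin_set_take) simp_all
  ultimately have "{j. j < n \<and> flip y (set (take i t)) ! j \<noteq> flip y (set (take (Suc i) t)) ! j} = {t ! i}"
    using i tD(3) by (auto simp: ly set_take_Suc)
  hence "card {j. j < n \<and> flip y (set (take i t)) ! j \<noteq> flip y (set (take (Suc i) t)) ! j} = 1"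
    by simp
  moreover have "flip y A \<in> hc_vertices n" for A using ly by (simp add: hc_vertices_def)
  ultimately show ?thesis unfolding walk_edge_def hc_edges_def by blast
qed

lemma oriented_diam_path_walk:
  assumes "y \<in> hc_vertices n" "t \<in> permutations_of_set {..<n}"
  shows "oriented_diam_path n (walk y t)"
proof -
  note tD = permutations_lessThanD[OF assms(2)] and ly = hc_verticesD[OF assms(1)]
  have "flip y A \<in> hc_vertices n" for A using ly by (simp add: hc_vertices_def)
  hence "set (walk y t) \<subseteq> hc_vertices n" by (auto simp: walk_def)
  moreover have "{walk y t ! i, walk y t ! Suc i} \<in> hc_edges n" if "i < n" for i
    using walk_edge_in_hc_edges[OF assms that] that tD by (simp add: nth_walk walk_edge_def)
  moreover have "walk y t ! n = map Not (walk y t ! 0)"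
    using tD ly by (simp add: nth_walk flip_UNIV)
  ultimately show ?thesis using tD by (simp add: oriented_diam_path_def)
qed

text \<open>Each of the \<open>n\<close> steps flips one coordinate and all \<open>n\<close> coordinates have to be flipped,
  so no coordinate is flipped twice.\<close>

lemma oriented_diam_path_imp_walk:
  assumes "oriented_diam_path n xs"
  obtains y t where "y \<in> hc_vertices n" "t \<in> permutations_of_set {..<n}" "xs = walk y t"
proof -
  have len: "length xs = Suc n" and sub: "set xs \<subseteq> hc_vertices n"
    and edges: "\<And>i. i < n \<Longrightarrow> {xs ! i, xs ! Suc i} \<in> hc_edges n"
    and last: "xs ! n = map Not (xs ! 0)"
    using assms by (auto simp: oriented_diam_path_def)
  have lx: "length (xs ! k) = n" if "k \<le> n" for k
    using hc_verticesD[OF subsetD[OF sub nth_mem[of k xs]]] len that by simp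
  have "\<exists>d. {j. j < n \<and> xs ! i ! j \<noteq> xs ! Suc i ! j} = {d}" if i: "i < n" for i
  proof -
    from edges[OF i] obtain x y
      where xy: "{xs ! i, xs ! Suc i} = {x, y}" "card {j. j < n \<and> x ! j \<noteq> y ! j} = 1"
      unfolding hc_edges_def by blast
    have sym: "{j. j < n \<and> y ! j \<noteq> x ! j} = {j. j < n \<and> x ! j \<noteq> y ! j}" by auto
    from xy(1) consider "xs ! i = x" "xs ! Suc i = y" | "xs ! i = y" "xs ! Suc i = x"
      unfolding doubleton_eq_iff by blast
    hence "card {j. j < n \<and> xs ! i ! j \<noteq> xs ! Suc i ! j} = 1"
      using xy(2) sym by cases simp_all
    thus ?thesis by (simp add: card_1_singleton_iff)
  qed
  then obtain d where d: "\<And>i. i < n \<Longrightarrow> {j. j < n \<and> xs ! i ! j \<noteq> xs ! Suc i ! j} = {d i}"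
    by metis
  define t where "t = map d [0..<n]"
  have len_t: "length t = n" by (simp add: t_def)
  have d_less: "d i < n" if "i < n" for i using d[OF that] by blast
  have const: "xs ! k ! j = xs ! 0 ! j" if "k \<le> n" "j < n" "j \<notin> d ` {..<k}" for k j
    using that
  proof (induction k)
    case (Suc k)
    have "j \<noteq> d k" using Suc.prems by auto
    hence "xs ! k ! j = xs ! Suc k ! j" using d[of k] Suc.prems by auto
    moreover have "xs ! k ! j = xs ! 0 ! j" using Suc.prems by (intro Suc.IH) auto
    ultimately show ?case by simp
  qed simp
  have "j \<in> d ` {..<n}" if "j < n" for j
    using const[of n j] that lx[of 0] by (auto simp: last)
  hence set_t: "set t = {..<n}" using d_less by (auto simp: t_def atLeast0LessThan)
  hence dist_t: "distinct t" using len_t by (intro card_distinct) simp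
  have main: "xs ! k = flip (xs ! 0) (set (take k t))" if "k \<le> n" for k
    using that
  proof (induction k)
    case (Suc k)
    have k: "k < n" using Suc.prems by simp
    have tk: "t ! k = d k" using k by (simp add: t_def)
    show ?case
    proof (rule nth_equalityI)
      fix j assume "j < length (xs ! Suc k)"
      hence j: "j < n" using lx[OF Suc.prems] by simp
      have "xs ! Suc k ! j \<longleftrightarrow> (xs ! k ! j) \<noteq> (j = d k)" using d[OF k] j by auto
      also have "xs ! k ! j \<longleftrightarrow> (xs ! 0 ! j) \<noteq> (j \<in> set (take k t))"
        using Suc.IH k j lx[of 0] by simp
      finally show "xs ! Suc k ! j = flip (xs ! 0) (set (take (Suc k) t)) ! j"
        using j lx[of 0] k len_t nth_notin_set_take[OF dist_t, of k]
        by (auto simp: set_take_Suc tk)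
    qed (use lx Suc.prems in simp)
  qed simp
  have "t \<in> permutations_of_set {..<n}" using set_t dist_t by (rule permutations_of_setI)
  moreover have "xs = walk (xs ! 0) t"
  proof (rule nth_equalityI)
    fix k assume "k < length xs"
    hence "k \<le> n" using len by simp
    thus "xs ! k = walk (xs ! 0) t ! k"
      using main[of k] nth_walk[of k t "xs ! 0"] len_t by metis
  qed (use len len_t in simp)
  moreover have "xs ! 0 \<in> hc_vertices n" using lx[of 0] by (simp add: hc_vertices_def)
  ultimately show ?thesis by (intro that)
qed

lemma walk_inj:
  assumes "y \<in> hc_vertices n" "t \<in> permutations_of_set {..<n}"
    "y' \<in> hc_vertices n" "t' \<in> permutations_of_set {..<n}" "walk y t = walk y' t'"
  shows "y = y'" "t = t'"
proof -
  show y: "y = y'" using assms(5) hd_walk by metis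
  note tD = permutations_lessThanD[OF assms(2)] permutations_lessThanD[OF assms(4)]
  have eq: "set (take k t) = set (take k t')" if "k \<le> n" for k
  proof -
    have "flip y (set (take k t)) = flip y (set (take k t'))"
      using arg_cong[OF assms(5), of "\<lambda>xs. xs ! k"] that tD by (simp add: nth_walk y)
    thus ?thesis using tD set_take_subset[of k t] set_take_subset[of k t'] hc_verticesD[OF assms(1)]
      by (subst (asm) flip_eq_iff) auto
  qed
  show "t = t'"
  proof (rule nth_equalityI)
    fix k assume "k < length t"
    hence k: "k < n" "k < length t" "k < length t'" using tD by auto
    show "t ! k = t' ! k"
      using eq[of k] eq[of "Suc k"] k nth_notin_set_take[of t k] nth_notin_set_take[of t' k] tD
      by (auto simp: set_take_Suc)
  qed (use tD in simp)
qed

lemma map_Not_neq: "y \<noteq> [] \<Longrightarrow> map Not y \<noteq> y"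
  by (cases y) simp_all

text \<open>For \<open>n \<ge> 1\<close> the endpoints are distinct antipodes. This makes the
  orientation of a path from 0 unique.\<close>

lemma rev_walk_neq:
  assumes "n \<ge> 1" "y \<in> hc_vertices n" "t \<in> permutations_of_set {..<n}"
  shows "hd (rev (walk y t)) \<noteq> y"
proof -
  note tD = permutations_lessThanD[OF assms(3)] and ly = hc_verticesD[OF assms(2)]
  have "hd (rev (walk y t)) = map Not y"
    using walk_rev[of t y] tD ly by (metis hd_walk)
  moreover have "map Not y \<noteq> y" using assms(1) ly by (intro map_Not_neq) auto
  ultimately show ?thesis by simp
qed

section \<open>Unoriented paths as classes of walks\<close>

definition path_class :: "vertex \<times> nat list \<Rightarrow> vertex list set" where
  "path_class z = {walk (fst z) (snd z), rev (walk (fst z) (snd z))}"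

definition oriented_walks :: "nat \<Rightarrow> (vertex \<times> nat list) set" where
  "oriented_walks n = hc_vertices n \<times> permutations_of_set {..<n}"

lemma finite_oriented_walks [simp]: "finite (oriented_walks n)"
  by (simp add: oriented_walks_def finite_hc_vertices)

lemma card_oriented_walks: "card (oriented_walks n) = 2 ^ n * fact n"
  by (simp add: oriented_walks_def card_cartesian_product card_hc_vertices)

lemma path_edges_path_class: "path_edges (path_class z) = walk_edges (fst z) (snd z)"
  by (simp add: path_class_def path_edges_walk)

lemma diam_paths_eq: "diam_paths n = path_class ` oriented_walks n"
proof
  show "diam_paths n \<subseteq> path_class ` oriented_walks n"
  proof
    fix d assume "d \<in> diam_paths n"
    then obtain xs where xs: "oriented_diam_path n xs" "d = {xs, rev xs}"
      by (auto simp: diam_paths_def)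
    from oriented_diam_path_imp_walk[OF xs(1)] obtain y t
      where "y \<in> hc_vertices n" "t \<in> permutations_of_set {..<n}" "xs = walk y t" .
    thus "d \<in> path_class ` oriented_walks n"
      by (intro image_eqI[of _ _ "(y, t)"]) (auto simp: xs(2) path_class_def oriented_walks_def)
  qed
  show "path_class ` oriented_walks n \<subseteq> diam_paths n"
    by (auto simp: diam_paths_def path_class_def oriented_walks_def intro!: oriented_diam_path_walk)
qed

definition reverse_walk :: "vertex \<times> nat list \<Rightarrow> vertex \<times> nat list" where
  "reverse_walk z = (map Not (fst z), rev (snd z))"

lemma reverse_walk_reverse_walk [simp]: "reverse_walk (reverse_walk z) = z"
proof -
  have "map Not (map Not y) = y" for y by (induction y) simp_all
  thus ?thesis by (simp add: reverse_walk_def del: map_map)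
qed

lemma reverse_walk_in [simp]: "z \<in> oriented_walks n \<Longrightarrow> reverse_walk z \<in> oriented_walks n"
  by (cases z) (simp add: oriented_walks_def reverse_walk_def hc_vertices_def permutations_of_set_def)

text \<open>The fibres of \<open>path_class\<close> consist of a walk and its reversal, which differ
  because their starts are antipodal.\<close>

lemma sum_diam_paths:
  fixes f :: "vertex list set \<Rightarrow> real"
  assumes "n \<ge> 1"
  shows "2 * (\<Sum>d\<in>diam_paths n. f d) = (\<Sum>z\<in>oriented_walks n. f (path_class z))"
proof -
  have fiber: "card {z' \<in> oriented_walks n. path_class z' = path_class z} = 2"
    if z: "z \<in> oriented_walks n" for z
  proof -
    obtain y t where yt: "z = (y, t)" "y \<in> hc_vertices n" "t \<in> permutations_of_set {..<n}"
      using z by (auto simp: oriented_walks_def)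
    note tD = permutations_lessThanD[OF yt(3)] and ly = hc_verticesD[OF yt(2)]
    have rev: "walk (map Not y) (rev t) = rev (walk y t)" using tD ly by (intro walk_rev) auto
    have neq: "map Not y \<noteq> y" using assms ly by (intro map_Not_neq) auto
    have inr: "map Not y \<in> hc_vertices n" "rev t \<in> permutations_of_set {..<n}"
      using ly tD(1,2) by (simp_all add: hc_vertices_def permutations_of_set_def)
    have "{z' \<in> oriented_walks n. path_class z' = path_class z} = {(y, t), (map Not y, rev t)}"
    proof (intro equalityI subsetI)
      fix z' assume z': "z' \<in> {z' \<in> oriented_walks n. path_class z' = path_class z}"
      obtain y' t' where yt': "z' = (y', t')" "y' \<in> hc_vertices n" "t' \<in> permutations_of_set {..<n}"
        using z' by (auto simp: oriented_walks_def)
      have "walk y' t' = walk y t \<or> walk y' t' = walk (map Not y) (rev t)"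
        using z' by (auto simp: yt yt' path_class_def doubleton_eq_iff rev)
      thus "z' \<in> {(y, t), (map Not y, rev t)}"
        using walk_inj[OF yt'(2,3) yt(2,3)] walk_inj[OF yt'(2,3) inr] by (auto simp: yt')
    qed (use yt inr in \<open>auto simp: path_class_def oriented_walks_def rev\<close>)
    thus ?thesis using neq by simp
  qed
  have "(\<Sum>z\<in>oriented_walks n. f (path_class z)) =
      (\<Sum>d\<in>path_class ` oriented_walks n. \<Sum>z | z \<in> oriented_walks n \<and> path_class z = d. f (path_class z))"
    by (rule sum.image_gen) simp
  also have "\<dots> = (\<Sum>d\<in>path_class ` oriented_walks n. 2 * f d)"
  proof (rule sum.cong[OF refl])
    fix d assume "d \<in> path_class ` oriented_walks n"
    then obtain z where z: "z \<in> oriented_walks n" "d = path_class z" by blast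
    have "(\<Sum>z' | z' \<in> oriented_walks n \<and> path_class z' = d. f (path_class z')) =
        (\<Sum>z' | z' \<in> oriented_walks n \<and> path_class z' = path_class z. f d)"
      by (rule sum.cong) (auto simp: z)
    also have "\<dots> = 2 * f d" by (simp add: fiber[OF z(1)])
    finally show "(\<Sum>z' | z' \<in> oriented_walks n \<and> path_class z' = d. f (path_class z')) = 2 * f d" .
  qed
  finally show ?thesis by (simp add: diam_paths_eq sum_distrib_left)
qed

text \<open>If the representing walk of a path with endpoint 0 ends there instead of starting there,
  the reversed permutation describes the same path from 0.\<close>

lemma diam_paths0_bij:
  assumes "n \<ge> 1"
  shows "bij_betw (\<lambda>t. path_class (hc_zero n, t)) (permutations_of_set {..<n}) (diam_paths0 n)"
proof -
  have z: "hc_zero n \<in> hc_vertices n" by (simp add: hc_zero_def hc_vertices_def)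
  have "inj_on (\<lambda>t. path_class (hc_zero n, t)) (permutations_of_set {..<n})"
  proof (rule inj_onI)
    fix t t' assume t: "t \<in> permutations_of_set {..<n}" "t' \<in> permutations_of_set {..<n}"
      and eq: "path_class (hc_zero n, t) = path_class (hc_zero n, t')"
    from eq have "walk (hc_zero n) t = walk (hc_zero n) t' \<or>
        walk (hc_zero n) t = rev (walk (hc_zero n) t')"
      by (auto simp: path_class_def doubleton_eq_iff)
    moreover have "walk (hc_zero n) t \<noteq> rev (walk (hc_zero n) t')"
      using rev_walk_neq[OF assms z t(2)] hd_walk by metis
    ultimately show "t = t'" using walk_inj(2)[OF z t(1) z t(2)] by blast
  qed
  moreover have "(\<lambda>t. path_class (hc_zero n, t)) ` permutations_of_set {..<n} = diam_paths0 n"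
  proof (intro equalityI subsetI)
    fix d assume d: "d \<in> diam_paths0 n"
    then obtain y t where yt: "y \<in> hc_vertices n" "t \<in> permutations_of_set {..<n}" "d = path_class (y, t)"
      by (auto simp: diam_paths0_def diam_paths_eq oriented_walks_def)
    note tD = permutations_lessThanD[OF yt(2)] and ly = hc_verticesD[OF yt(1)]
    have rev: "walk (map Not y) (rev t) = rev (walk y t)" using tD ly by (intro walk_rev) auto
    have "hd (walk y t) = hc_zero n \<or> hd (rev (walk y t)) = hc_zero n"
      using d by (auto simp: diam_paths0_def yt path_class_def)
    thus "d \<in> (\<lambda>t. path_class (hc_zero n, t)) ` permutations_of_set {..<n}"
    proof
      assume "hd (walk y t) = hc_zero n"
      hence "d = path_class (hc_zero n, t)" using yt by simp
      thus ?thesis using yt(2) by blast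
    next
      assume "hd (rev (walk y t)) = hc_zero n"
      hence "map Not y = hc_zero n" unfolding rev[symmetric] by simp
      with rev have "walk (hc_zero n) (rev t) = rev (walk y t)" by simp
      hence "d = path_class (hc_zero n, rev t)"
        by (simp add: yt path_class_def insert_commute)
      moreover have "rev t \<in> permutations_of_set {..<n}"
        using tD by (simp add: permutations_of_set_def)
      ultimately show ?thesis by blast
    qed
  next
    fix d assume "d \<in> (\<lambda>t. path_class (hc_zero n, t)) ` permutations_of_set {..<n}"
    then obtain t where t: "t \<in> permutations_of_set {..<n}" "d = path_class (hc_zero n, t)" by blast
    have "d \<in> diam_paths n"
      unfolding diam_paths_eq t(2) using t(1) z by (auto simp: oriented_walks_def)
    moreover have "walk (hc_zero n) t \<in> d" by (simp add: t path_class_def)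
    hence "\<exists>xs\<in>d. hd xs = hc_zero n" using hd_walk by blast
    ultimately show "d \<in> diam_paths0 n" by (simp add: diam_paths0_def)
  qed
  ultimately show ?thesis by (simp add: bij_betw_def)
qed

section \<open>Common edges of two diameter paths\<close>

lemma sum_Un_le:
  fixes g :: "'a \<Rightarrow> real"
  assumes "finite A" "finite B" "\<And>x. g x \<ge> 0"
  shows "sum g (A \<union> B) \<le> sum g A + sum g B"
  using sum.union_inter[OF assms(1,2), of g] sum_nonneg[of "A \<inter> B" g] assms(3) by simp

lemma sum_UN_le:
  fixes g :: "'a \<Rightarrow> real"
  assumes "finite I" "\<And>i. i \<in> I \<Longrightarrow> finite (A i)" "\<And>x. g x \<ge> 0"
  shows "sum g (\<Union>i\<in>I. A i) \<le> (\<Sum>i\<in>I. sum g (A i))"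
  using assms(1,2)
proof (induction I rule: finite_induct)
  case (insert i I)
  have "sum g (\<Union>j\<in>insert i I. A j) \<le> sum g (A i) + sum g (\<Union>j\<in>I. A j)"
    using insert assms(3) by (simp add: sum_Un_le)
  thus ?case using insert by simp
qed simp

lemma card_diam_paths:
  assumes "n \<ge> 1"
  shows "2 * real (card (diam_paths n)) = 2 ^ n * fact n"
  using sum_diam_paths[OF assms, of "\<lambda>_. 1"] by (simp add: card_oriented_walks)

lemma card_diam_paths0:
  assumes "n \<ge> 1"
  shows "card (diam_paths0 n) = fact n"
  using bij_betw_same_card[OF diam_paths0_bij[OF assms]] by simp

lemma card_path_edges:
  assumes "d \<in> diam_paths n"
  shows "card (path_edges d) = n"
proof -
  obtain y t where yt: "y \<in> hc_vertices n" "t \<in> permutations_of_set {..<n}" "d = path_class (y, t)"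
    using assms unfolding diam_paths_eq oriented_walks_def by blast
  show ?thesis
    unfolding yt(3) path_edges_path_class
    using card_walk_edges[of t y] permutations_lessThanD[OF yt(2)] hc_verticesD[OF yt(1)] by simp
qed

lemma path_edges_subset:
  assumes "d \<in> diam_paths n"
  shows "path_edges d \<subseteq> hc_edges n"
proof -
  obtain y t where yt: "y \<in> hc_vertices n" "t \<in> permutations_of_set {..<n}" "d = path_class (y, t)"
    using assms unfolding diam_paths_eq oriented_walks_def by blast
  show ?thesis
    unfolding yt(3) path_edges_path_class
    using walk_edge_in_hc_edges[OF yt(1,2)] permutations_lessThanD(3)[OF yt(2)]
    by (auto simp: walk_edges_def)
qed

text \<open>With the first path fixed, this is the counting lemma with \<open>l = 0\<close>: the
  starts agree, so no prefix has to be skipped.\<close>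

lemma sum_overlap_diam_paths0:
  fixes q :: real
  assumes n: "n \<ge> 1" and q: "q \<ge> 1"
  shows "(\<Sum>d\<in>diam_paths0 n. \<Sum>d'\<in>diam_paths0 n. q ^ card (path_edges d \<inter> path_edges d'))
     \<le> fact n * overlap_sum q n"
proof -
  define S where "S = permutations_of_set {..<n}"
  have z: "length (hc_zero n) = n" by (simp add: hc_zero_def)
  have reindex: "(\<Sum>d\<in>diam_paths0 n. f d) = (\<Sum>t\<in>S. f (path_class (hc_zero n, t)))"
    for f :: "_ \<Rightarrow> real"
    unfolding S_def by (rule sum.reindex_bij_betw[OF diam_paths0_bij[OF n], symmetric])
  have "(\<Sum>d\<in>diam_paths0 n. \<Sum>d'\<in>diam_paths0 n. q ^ card (path_edges d \<inter> path_edges d')) =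
     (\<Sum>s\<in>S. \<Sum>t\<in>S. q ^ card (walk_edges (hc_zero n) s \<inter> walk_edges (hc_zero n) t))"
    by (simp add: reindex path_edges_path_class)
  also have "\<dots> \<le> (\<Sum>s\<in>S. overlap_sum q n)"
  proof (rule sum_mono)
    fix s assume s: "s \<in> S"
    note sD = permutations_lessThanD[OF s[unfolded S_def]]
    have "(\<Sum>t\<in>S. q ^ card (walk_edges (hc_zero n) s \<inter> walk_edges (hc_zero n) t)) \<le>
        (\<Sum>t\<in>S. q ^ card (common_steps s (drop 0 t)))"
    proof (rule sum_mono)
      fix t assume t: "t \<in> S"
      note tD = permutations_lessThanD[OF t[unfolded S_def]]
      have "card (walk_edges (hc_zero n) s \<inter> walk_edges (hc_zero n) t) \<le> card (common_steps s t)"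
        by (rule card_walk_edges_Int_same_start) (simp_all add: sD tD z)
      thus "q ^ card (walk_edges (hc_zero n) s \<inter> walk_edges (hc_zero n) t) \<le>
          q ^ card (common_steps s (drop 0 t))" using q by (simp add: power_increasing)
    qed
    also have "\<dots> \<le> overlap_sum q (card {..<n})"
      unfolding S_def by (rule sum_power_common_steps_le) (use q sD in simp_all)
    finally show "(\<Sum>t\<in>S. q ^ card (walk_edges (hc_zero n) s \<inter> walk_edges (hc_zero n) t)) \<le> overlap_sum q n"
      by simp
  qed
  finally show ?thesis by (simp add: S_def)
qed

lemma steps_on_reverse_walk:
  assumes "z \<in> oriented_walks n"
  shows "steps_on x s (fst (reverse_walk z)) (snd (reverse_walk z)) = steps_on x s (fst z) (snd z)"
proof -
  obtain y t where yt: "y \<in> hc_vertices n" "t \<in> permutations_of_set {..<n}" "z = (y, t)"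
    using assms unfolding oriented_walks_def by blast
  have "walk_edges (map Not y) (rev t) = walk_edges y t"
    using permutations_lessThanD[OF yt(2)] hc_verticesD[OF yt(1)] by (intro walk_edges_rev) simp_all
  thus ?thesis by (simp add: steps_on_def reverse_walk_def yt)
qed

text \<open>Both the time and the direction of the passage are recorded: the direction is needed for
  comparing the parts after the edge, and the time for recovering the start.\<close>

definition traverses :: "nat \<Rightarrow> vertex \<Rightarrow> vertex \<Rightarrow> nat \<Rightarrow> (vertex \<times> nat list) set" where
  "traverses n v w l = {z \<in> oriented_walks n.
     v = flip (fst z) (set (take l (snd z))) \<and> w = flip (fst z) (set (take (Suc l) (snd z)))}"

lemma reverse_walk_traverses:
  assumes "z \<in> traverses n v w l" "l < n"
  shows "reverse_walk z \<in> traverses n w v (n - Suc l)"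
proof -
  obtain y t where yt: "y \<in> hc_vertices n" "t \<in> permutations_of_set {..<n}" "z = (y, t)"
    using assms unfolding traverses_def oriented_walks_def by blast
  note tD = permutations_lessThanD[OF yt(2)] and ly = hc_verticesD[OF yt(1)]
  have "flip (map Not y) (set (take k (rev t))) = flip y (set (take (n - k) t))" if "k \<le> n" for k
    using flip_rev[of t y k] tD ly that by simp
  from this[of "n - Suc l"] this[of "Suc (n - Suc l)"]
  have "flip (map Not y) (set (take (n - Suc l) (rev t))) = flip y (set (take (Suc l) t))"
    "flip (map Not y) (set (take (Suc (n - Suc l)) (rev t))) = flip y (set (take l t))"
    using assms(2) by (simp_all add: Suc_diff_Suc)
  moreover have "reverse_walk z \<in> oriented_walks n"
    using assms(1) by (intro reverse_walk_in) (simp add: traverses_def)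
  ultimately show ?thesis
    using assms(1) unfolding traverses_def yt(3) reverse_walk_def by simp
qed

text \<open>A walk that passes a given oriented edge at time \<open>l\<close> must have
  \<open>s ! k\<close> as its \<open>l\<close>-th entry, and its start is determined by its
  permutation. Only the order of the other \<open>n - 1\<close> coordinates is free. The 2 ^ n
  choices of the start are lost here, which is the source of the gain of 2 ^ - n.\<close>

lemma sum_traverses_le:
  fixes q :: real
  assumes q: "q \<ge> 1" and x: "x \<in> hc_vertices n" and s: "s \<in> permutations_of_set {..<n}"
    and k: "k < n" and l: "l < n"
  shows "(\<Sum>z\<in>traverses n (flip x (set (take k s))) (flip x (set (take (Suc k) s))) l.
            q ^ card {j \<in> steps_on x s (fst z) (snd z). k < j}) \<le> overlap_sum q (n - 1)"
proof -
  define T where "T = traverses n (flip x (set (take k s))) (flip x (set (take (Suc k) s))) l"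
  define B where "B = {..<n} - {s ! k}"
  define h where "h z = take l (snd z) @ drop (Suc l) (snd z)" for z :: "vertex \<times> nat list"
  define s' where "s' = drop (Suc k) s"
  note sD = permutations_lessThanD[OF s] and lx = hc_verticesD[OF x]
  have T: "fst z \<in> hc_vertices n" "snd z \<in> permutations_of_set {..<n}"
     "flip x (set (take k s)) = flip (fst z) (set (take l (snd z)))"
     "flip x (set (take (Suc k) s)) = flip (fst z) (set (take (Suc l) (snd z)))" if "z \<in> T" for z
    using that by (auto simp: T_def traverses_def oriented_walks_def)
  have after: "s ! k = snd z ! l"
      "card {j \<in> steps_on x s (fst z) (snd z). k < j} \<le> card (common_steps s' (drop l (h z)))"
    if "z \<in> T" for z
  proof -
    note zD = permutations_lessThanD[OF T(2)[OF that]] and lz = hc_verticesD[OF T(1)[OF that]]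
    have "drop l (h z) = drop (Suc l) (snd z)" using zD(3) l by (simp add: h_def)
    thus "s ! k = snd z ! l"
      "card {j \<in> steps_on x s (fst z) (snd z). k < j} \<le> card (common_steps s' (drop l (h z)))"
      using card_steps_on_after[of s x "snd z" "fst z" k l] T(3,4)[OF that] sD zD lz lx k l
      by (simp_all add: s'_def)
  qed
  have decomp: "snd z = take l (snd z) @ s ! k # drop (Suc l) (snd z)" if "z \<in> T" for z
    unfolding after(1)[OF that] using permutations_lessThanD[OF T(2)[OF that]] l
    by (simp add: id_take_nth_drop[symmetric])
  have inj: "inj_on h T"
  proof (rule inj_onI)
    fix z z' assume z: "z \<in> T" "z' \<in> T" and hh: "h z = h z'"
    note zD = permutations_lessThanD[OF T(2)[OF z(1)]] permutations_lessThanD[OF T(2)[OF z(2)]]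
    have "take l (snd z) = take l (snd z')" "drop (Suc l) (snd z) = drop (Suc l) (snd z')"
      using hh zD(3,6) l by (simp_all add: h_def)
    hence eq: "snd z = snd z'" using decomp[OF z(1)] decomp[OF z(2)] by metis
    \<comment> \<open>Flipping is an involution, so the start is recovered from the prescribed
      vertex and the prefix of the permutation.\<close>
    have "flip (flip (fst z) A) A = fst z" for z :: "vertex \<times> nat list" and A
      by (simp add: flip_flip)
    hence "fst z = fst z'" using T(3)[OF z(1)] T(3)[OF z(2)] eq by metis
    with eq show "z = z'" by (simp add: prod_eq_iff)
  qed
  have range: "h ` T \<subseteq> permutations_of_set B"
  proof
    fix u assume "u \<in> h ` T"
    then obtain z where z: "z \<in> T" "u = h z" by blast
    note zD = permutations_lessThanD[OF T(2)[OF z(1)]]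
    define a where "a = take l (snd z)"
    define c where "c = drop (Suc l) (snd z)"
    have eq: "snd z = a @ s ! k # c" unfolding a_def c_def by (rule decomp[OF z(1)])
    have "set (a @ c) = B" "distinct (a @ c)"
      using zD(2) unfolding B_def zD(1)[symmetric] eq by auto
    thus "u \<in> permutations_of_set B" unfolding z(2) h_def a_def[symmetric] c_def[symmetric]
      by (rule permutations_of_setI)
  qed
  have "(\<Sum>z\<in>T. q ^ card {j \<in> steps_on x s (fst z) (snd z). k < j}) \<le>
      (\<Sum>z\<in>T. q ^ card (common_steps s' (drop l (h z))))"
    using q by (intro sum_mono power_increasing after(2)) auto
  also have "\<dots> = (\<Sum>u\<in>h ` T. q ^ card (common_steps s' (drop l u)))"
    by (simp add: sum.reindex[OF inj])
  also have "\<dots> \<le> (\<Sum>u\<in>permutations_of_set B. q ^ card (common_steps s' (drop l u)))"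
    using q by (intro sum_mono2 range) simp_all
  also have "\<dots> \<le> overlap_sum q (card B)"
  proof (rule sum_power_common_steps_le)
    have "s = take k s @ s ! k # s'"
      unfolding s'_def using sD k by (simp add: id_take_nth_drop[symmetric])
    hence "distinct (take k s @ s ! k # s')" "set s' \<subseteq> {..<n}"
      using sD(2) sD(1) set_drop_subset[of "Suc k" s] unfolding s'_def by simp_all
    thus "distinct s'" "set s' \<subseteq> B" by (auto simp: B_def)
  qed (use q in \<open>simp_all add: B_def\<close>)
  also have "s ! k < n" using sD k by (metis lessThan_iff nth_mem)
  hence "card B = n - 1" by (simp add: B_def)
  finally show ?thesis unfolding T_def .
qed

text \<open>The first edge of the walk \<open>(x, s)\<close> that the other walk shares is traversed by the latter in
  one of the two directions; reversing the other walk reduces the second case to the first one.\<close>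

lemma sum_overlap_oriented_walks:
  fixes q :: real
  assumes n: "n \<ge> 1" and q: "q \<ge> 1" and x: "x \<in> hc_vertices n" and s: "s \<in> permutations_of_set {..<n}"
  shows "(\<Sum>z\<in>oriented_walks n. q ^ card (walk_edges x s \<inter> walk_edges (fst z) (snd z))) \<le>
     2 ^ n * fact n + 2 * real n ^ 2 * overlap_sum q n"
proof -
  define C where "C z = steps_on x s (fst z) (snd z)" for z
  define G where "G k z = q ^ card {j \<in> C z. k < j}" for k z
  note sD = permutations_lessThanD[OF s]
  have G_nonneg: "G k z \<ge> 0" for k z using q by (simp add: G_def)
  have step: "(\<Sum>z | z \<in> oriented_walks n \<and> k \<in> C z. G k z) \<le> 2 * (real n * overlap_sum q (n - 1))"
    if k: "k < n" for k
  proof -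
    define v where "v = flip x (set (take k s))"
    define w where "w = flip x (set (take (Suc k) s))"
    have fin: "finite (traverses n v w l)" for v w l
      by (rule finite_subset[OF _ finite_oriented_walks[of n]]) (auto simp: traverses_def)
    have bound: "(\<Sum>z\<in>traverses n v w l. G k z) \<le> overlap_sum q (n - 1)" if "l < n" for l
      using sum_traverses_le[OF q x s k that] by (simp add: G_def C_def v_def w_def)
    have bound': "(\<Sum>z\<in>traverses n w v l. G k z) \<le> overlap_sum q (n - 1)" if l: "l < n" for l
    proof -
      have "inj_on reverse_walk (traverses n w v l)"
        by (rule inj_onI) (metis reverse_walk_reverse_walk)
      hence "(\<Sum>z\<in>reverse_walk ` traverses n w v l. G k z) =
          (\<Sum>z\<in>traverses n w v l. G k (reverse_walk z))"
        by (simp add: sum.reindex)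
      also have "\<dots> = (\<Sum>z\<in>traverses n w v l. G k z)"
        by (rule sum.cong) (auto simp: G_def C_def traverses_def steps_on_reverse_walk)
      finally have "(\<Sum>z\<in>traverses n w v l. G k z) = (\<Sum>z\<in>reverse_walk ` traverses n w v l. G k z)" ..
      also have "\<dots> \<le> (\<Sum>z\<in>traverses n v w (n - Suc l). G k z)"
        using reverse_walk_traverses l by (intro sum_mono2 fin G_nonneg) auto
      also have "\<dots> \<le> overlap_sum q (n - 1)" using l by (intro bound) simp
      finally show ?thesis .
    qed
    \<comment> \<open>The other walk may use the edge at any of \<open>n\<close> times and in two
      directions. With the \<open>n\<close> choices of \<open>k\<close> this produces the factor
      \<open>2 * real n ^ 2\<close>.\<close>
    have cover: "{z. z \<in> oriented_walks n \<and> k \<in> C z} \<subseteq>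
        (\<Union>l<n. traverses n v w l) \<union> (\<Union>l<n. traverses n w v l)"
    proof
      fix z assume z: "z \<in> {z. z \<in> oriented_walks n \<and> k \<in> C z}"
      have "length (snd z) = n"
        using z length_finite_permutations_of_set[of "snd z" "{..<n}"]
        by (auto simp: oriented_walks_def)
      then obtain l where "l < n" "walk_edge x s k = walk_edge (fst z) (snd z) l"
        using z by (auto simp: C_def steps_on_def walk_edges_def)
      thus "z \<in> (\<Union>l<n. traverses n v w l) \<union> (\<Union>l<n. traverses n w v l)"
        using z unfolding walk_edge_def doubleton_eq_iff v_def[symmetric] w_def[symmetric]
        by (auto simp: traverses_def)
    qed
    have "(\<Sum>z | z \<in> oriented_walks n \<and> k \<in> C z. G k z) \<le>
        (\<Sum>z\<in>(\<Union>l<n. traverses n v w l) \<union> (\<Union>l<n. traverses n w v l). G k z)"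
      using fin by (intro sum_mono2 cover G_nonneg) auto
    also have "\<dots> \<le> (\<Sum>z\<in>(\<Union>l<n. traverses n v w l). G k z) + (\<Sum>z\<in>(\<Union>l<n. traverses n w v l). G k z)"
      using fin by (intro sum_Un_le G_nonneg) auto
    also have "\<dots> \<le> (\<Sum>l<n. \<Sum>z\<in>traverses n v w l. G k z) + (\<Sum>l<n. \<Sum>z\<in>traverses n w v l. G k z)"
      using fin G_nonneg by (intro add_mono sum_UN_le) auto
    also have "\<dots> \<le> (\<Sum>l<n. overlap_sum q (n - 1)) + (\<Sum>l<n. overlap_sum q (n - 1))"
      by (intro add_mono sum_mono bound bound') auto
    finally show ?thesis by simp
  qed
  have "(\<Sum>z\<in>oriented_walks n. q ^ card (walk_edges x s \<inter> walk_edges (fst z) (snd z))) \<le>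
      (\<Sum>z\<in>oriented_walks n. q ^ card (C z))"
    unfolding C_def using q by (intro sum_mono power_increasing card_walk_edges_Int_le)
  also have "\<dots> \<le> real (card (oriented_walks n)) +
      q * (\<Sum>k<n. \<Sum>z | z \<in> oriented_walks n \<and> k \<in> C z. G k z)"
    unfolding G_def using q by (intro sum_power_card_le) (auto simp: C_def steps_on_def sD(3))
  also have "\<dots> \<le> real (card (oriented_walks n)) +
      q * (\<Sum>k<n. 2 * (real n * overlap_sum q (n - 1)))"
    using q step by (intro add_left_mono mult_left_mono sum_mono) auto
  also have "\<dots> = 2 ^ n * fact n + 2 * real n ^ 2 * (q * overlap_sum q (n - 1))"
    by (simp add: card_oriented_walks power2_eq_square)
  \<comment> \<open>The factor \<open>q\<close> of the fixed edge is absorbed: the left side is the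
    summand \<open>j = 0\<close> of the recursion.\<close>
  also have "q * overlap_sum q (n - 1) \<le> overlap_sum q n"
  proof -
    have "overlap_sum q (n - Suc 0) = fact 0 * overlap_sum q (n - Suc 0)" by simp
    also have "\<dots> \<le> (\<Sum>j<n. fact j * overlap_sum q (n - Suc j))"
      using n q by (intro member_le_sum) (auto intro!: mult_nonneg_nonneg overlap_sum_nonneg)
    finally have "q * overlap_sum q (n - 1) \<le> q * (\<Sum>j<n. fact j * overlap_sum q (n - Suc j))"
      using q by (intro mult_left_mono) auto
    also have "\<dots> \<le> overlap_sum q n" by (subst (2) overlap_sum_rec) simp
    finally show ?thesis .
  qed
  finally show ?thesis by (simp add: mult_left_mono)
qed

lemma sum_overlap_diam_paths:
  fixes q :: real
  assumes n: "n \<ge> 1" and q: "q \<ge> 1"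
  shows "4 * (\<Sum>d\<in>diam_paths n. \<Sum>d'\<in>diam_paths n. q ^ card (path_edges d \<inter> path_edges d'))
     \<le> 2 ^ n * fact n * (2 ^ n * fact n + 2 * real n ^ 2 * overlap_sum q n)"
proof -
  have "4 * (\<Sum>d\<in>diam_paths n. \<Sum>d'\<in>diam_paths n. q ^ card (path_edges d \<inter> path_edges d')) =
     2 * (\<Sum>d\<in>diam_paths n. 2 * (\<Sum>d'\<in>diam_paths n. q ^ card (path_edges d \<inter> path_edges d')))"
    by (simp add: sum_distrib_left)
  also have "\<dots> = (\<Sum>w\<in>oriented_walks n. \<Sum>z\<in>oriented_walks n.
      q ^ card (walk_edges (fst w) (snd w) \<inter> walk_edges (fst z) (snd z)))"
    unfolding sum_diam_paths[OF n] path_edges_path_class ..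
  also have "\<dots> \<le> (\<Sum>w\<in>oriented_walks n. 2 ^ n * fact n + 2 * real n ^ 2 * overlap_sum q n)"
    using n q by (intro sum_mono sum_overlap_oriented_walks) (auto simp: oriented_walks_def)
  also have "\<dots> = 2 ^ n * fact n * (2 ^ n * fact n + 2 * real n ^ 2 * overlap_sum q n)"
    by (simp add: card_oriented_walks)
  finally show ?thesis .
qed

section \<open>The random hypercube and its tampered version\<close>

definition edge_law :: "edge set \<Rightarrow> real \<Rightarrow> edge set pmf" where
  "edge_law X p = map_pmf (\<lambda>kept. {e \<in> X. kept e}) (Pi_pmf X False (\<lambda>_. bernoulli_pmf p))"

lemma hc_law_eq_edge_law: "hc_law n p = edge_law (hc_edges n) p"
  by (simp add: hc_law_def edge_law_def)

lemma set_pmf_edge_law: "set_pmf (edge_law X p) \<subseteq> Pow X"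
  by (auto simp: edge_law_def)

lemma finite_set_pmf_hc_law [simp]: "finite (set_pmf (hc_law n p))"
  unfolding hc_law_eq_edge_law
  by (rule finite_subset[OF set_pmf_edge_law]) (simp add: finite_hc_edges)

lemma edge_law_Un:
  assumes "finite A" "finite B" "A \<inter> B = {}"
  shows "edge_law (A \<union> B) p = map_pmf (\<lambda>(F, G). F \<union> G) (pair_pmf (edge_law A p) (edge_law B p))"
proof -
  have "{e \<in> A \<union> B. if e \<in> A then f e else g e} = {e \<in> A. f e} \<union> {e \<in> B. g e}" for f g
    using assms(3) by auto
  thus ?thesis
    unfolding edge_law_def map_pair[symmetric] Pi_pmf_union[OF assms] map_pmf_comp
    by (intro map_pmf_cong) (auto simp: split_beta)
qed

lemma prob_edge_law_all:
  assumes "finite S" "0 \<le> p" "p \<le> 1"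
  shows "measure_pmf.prob (edge_law S p) {S} = p ^ card S"
proof -
  have "(\<lambda>kept. {e \<in> S. kept e}) -` {S} = Pi S (\<lambda>_. {True})" by auto
  thus ?thesis using assms
    unfolding edge_law_def measure_map_pmf by (simp add: measure_Pi_pmf_Pi measure_pmf_single)
qed

lemma prob_edge_law_none:
  assumes "finite S" "0 \<le> p" "p \<le> 1"
  shows "measure_pmf.prob (edge_law S p) {{}} = (1 - p) ^ card S"
proof -
  have "(\<lambda>kept. {e \<in> S. kept e}) -` {{}} = Pi S (\<lambda>_. {False})" by auto
  thus ?thesis using assms
    unfolding edge_law_def measure_map_pmf by (simp add: measure_Pi_pmf_Pi measure_pmf_single)
qed

lemma prob_cong_set_pmf:
  assumes "\<And>x. x \<in> set_pmf M \<Longrightarrow> x \<in> A \<longleftrightarrow> x \<in> B"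
  shows "measure_pmf.prob M A = measure_pmf.prob M B"
proof -
  have "A \<inter> set_pmf M = B \<inter> set_pmf M" using assms by auto
  thus ?thesis by (metis measure_Int_set_pmf)
qed

text \<open>The event \<open>A\<close> has to factor only on configurations inside the hypercube, as
  these carry all the mass. The inclusions of \<open>K\<close> and \<open>L\<close> provide the
  countability used in the product rule.\<close>

lemma prob_hc_law_product:
  assumes S: "S \<subseteq> hc_edges n" and K: "K \<subseteq> Pow S" and L: "L \<subseteq> Pow (hc_edges n - S)"
    and A: "\<And>F G. F \<subseteq> S \<Longrightarrow> G \<subseteq> hc_edges n - S \<Longrightarrow> F \<union> G \<in> A \<longleftrightarrow> F \<in> K \<and> G \<in> L"
  shows "measure_pmf.prob (hc_law n p) A =
     measure_pmf.prob (edge_law S p) K * measure_pmf.prob (edge_law (hc_edges n - S) p) L"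
proof -
  have fin: "finite S" "finite (hc_edges n - S)"
    using S finite_hc_edges finite_subset by auto
  have "hc_edges n = S \<union> (hc_edges n - S)" using S by auto
  hence "hc_law n p = map_pmf (\<lambda>(F, G). F \<union> G) (pair_pmf (edge_law S p) (edge_law (hc_edges n - S) p))"
    unfolding hc_law_eq_edge_law by (metis edge_law_Un fin Diff_disjoint)
  hence "measure_pmf.prob (hc_law n p) A = measure_pmf.prob
     (pair_pmf (edge_law S p) (edge_law (hc_edges n - S) p)) ((\<lambda>(F, G). F \<union> G) -` A)"
    by simp
  also have "\<dots> = measure_pmf.prob (pair_pmf (edge_law S p) (edge_law (hc_edges n - S) p)) (K \<times> L)"
  proof (rule prob_cong_set_pmf)
    fix z assume "z \<in> set_pmf (pair_pmf (edge_law S p) (edge_law (hc_edges n - S) p))"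
    hence "fst z \<subseteq> S" "snd z \<subseteq> hc_edges n - S"
      using subsetD[OF set_pmf_edge_law, of "fst z" S p]
        subsetD[OF set_pmf_edge_law, of "snd z" "hc_edges n - S" p] by auto
    from A[OF this] show "z \<in> (\<lambda>(F, G). F \<union> G) -` A \<longleftrightarrow> z \<in> K \<times> L"
      by (cases z) simp
  qed
  also have "\<dots> = measure_pmf.prob (edge_law S p) K * measure_pmf.prob (edge_law (hc_edges n - S) p) L"
    using fin K L
    by (intro measure_pmf_prob_product) (meson countable_finite finite_Pow_iff finite_subset)+
  finally show ?thesis .
qed

text \<open>Whether \<open>E \<union> S\<close> lies in \<open>A\<close> depends only on the edges
  outside \<open>S\<close>, which are independent of those in \<open>S\<close>. This is the
  statement that adjoining \<open>S\<close> amounts to conditioning on its presence.\<close>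

lemma prob_hc_law_superset:
  assumes S: "S \<subseteq> hc_edges n" and p: "0 \<le> p" "p \<le> 1"
  shows "measure_pmf.prob (hc_law n p) {E \<in> A. S \<subseteq> E} =
     p ^ card S * measure_pmf.prob (hc_law n p) {E. E \<union> S \<in> A}"
proof -
  define L where "L = {G. G \<subseteq> hc_edges n - S \<and> S \<union> G \<in> A}"
  have fin: "finite S" using S finite_hc_edges finite_subset by auto
  have "F = S" if "F \<subseteq> S" "G \<subseteq> hc_edges n - S" "S \<subseteq> F \<union> G" for F G
    using that by auto
  hence "measure_pmf.prob (hc_law n p) {E \<in> A. S \<subseteq> E} =
      measure_pmf.prob (edge_law S p) {S} * measure_pmf.prob (edge_law (hc_edges n - S) p) L"
    using S by (intro prob_hc_law_product) (auto simp: L_def)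
  moreover have "F \<union> G \<union> S = S \<union> G" if "F \<subseteq> S" for F G :: "edge set" using that by auto
  hence "measure_pmf.prob (hc_law n p) {E. E \<union> S \<in> A} =
      measure_pmf.prob (edge_law S p) (Pow S) * measure_pmf.prob (edge_law (hc_edges n - S) p) L"
    using S by (intro prob_hc_law_product) (auto simp: L_def)
  moreover have "measure_pmf.prob (edge_law S p) (Pow S) = 1"
    using prob_cong_set_pmf[of "edge_law S p" "Pow S" UNIV] set_pmf_edge_law[of S p] by auto
  ultimately show ?thesis using prob_edge_law_all[OF fin p] by simp
qed

lemma prob_hc_law_contains:
  assumes "S \<subseteq> hc_edges n" "0 \<le> p" "p \<le> 1"
  shows "measure_pmf.prob (hc_law n p) {E. S \<subseteq> E} = p ^ card S"
  using prob_hc_law_superset[OF assms, of UNIV] by simp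

lemma prob_hc_law_disjoint:
  assumes S: "S \<subseteq> hc_edges n" and p: "0 \<le> p" "p \<le> 1"
  shows "measure_pmf.prob (hc_law n p) {E. E \<inter> S = {}} = (1 - p) ^ card S"
proof -
  have fin: "finite S" using S finite_hc_edges finite_subset by auto
  have "measure_pmf.prob (hc_law n p) {E. E \<inter> S = {}} = measure_pmf.prob (edge_law S p) {{}} *
      measure_pmf.prob (edge_law (hc_edges n - S) p) (Pow (hc_edges n - S))"
    using S by (intro prob_hc_law_product) auto
  moreover have "measure_pmf.prob (edge_law (hc_edges n - S) p) (Pow (hc_edges n - S)) = 1"
    using prob_cong_set_pmf[of "edge_law (hc_edges n - S) p" "Pow (hc_edges n - S)" UNIV]
      set_pmf_edge_law[of "hc_edges n - S" p] by auto
  ultimately show ?thesis using prob_edge_law_none[OF fin p] by simp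
qed

section \<open>Tampering as a change of measure\<close>

lemma prob_tamper:
  assumes "finite D" "D \<noteq> {}" "finite (set_pmf P)"
  shows "measure_pmf.prob (tamper P D) A =
    (\<Sum>d\<in>D. measure_pmf.prob P {E. E \<union> path_edges d \<in> A}) / real (card D)"
proof -
  \<comment> \<open>The path is drawn before the configuration, which exhibits the tampered law as a
    uniform mixture over \<open>D\<close>.\<close>
  have eq: "tamper P D = pmf_of_set D \<bind> (\<lambda>d. map_pmf (\<lambda>E. E \<union> path_edges d) P)"
    unfolding tamper_def pair_pmf_def map_bind_pmf map_return_pmf
    by (subst bind_commute_pmf) (simp add: map_pmf_def)
  have "measure_pmf.prob (tamper P D) A = measure_pmf.expectation (tamper P D) (indicator A)"
    by simp
  also have "\<dots> = (\<Sum>d\<in>D. measure_pmf.expectation (map_pmf (\<lambda>E. E \<union> path_edges d) P) (indicator A) /\<^sub>R real (card D))"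
    unfolding eq using assms by (intro pmf_expectation_bind_pmf_of_set) auto
  also have "\<dots> = (\<Sum>d\<in>D. measure_pmf.prob P {E. E \<union> path_edges d \<in> A}) / real (card D)"
  proof -
    have "measure_pmf.expectation (map_pmf (\<lambda>E. E \<union> path_edges d) P) (indicator A :: _ \<Rightarrow> real) =
        measure_pmf.prob (map_pmf (\<lambda>E. E \<union> path_edges d) P) A" for d by simp
    also have "\<And>d. \<dots> d = measure_pmf.prob P {E. E \<union> path_edges d \<in> A}"
      unfolding measure_map_pmf by (simp add: vimage_def)
    finally show ?thesis by (simp add: sum_distrib_left divide_inverse mult.commute)
  qed
  finally show ?thesis .
qed

definition path_count :: "vertex list set set \<Rightarrow> edge set \<Rightarrow> nat" where
  "path_count D E = card {d \<in> D. path_edges d \<subseteq> E}"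

definition rel_count :: "nat \<Rightarrow> real \<Rightarrow> vertex list set set \<Rightarrow> edge set \<Rightarrow> real" where
  "rel_count n p D E = real (path_count D E) / (real (card D) * p ^ n)"

text \<open>A purely combinatorial mean over pairs of paths, to which the counting bounds apply; at
  q = 1 / p with p > 0 it is the second moment of \<open>rel_count\<close>.\<close>

definition rel_second_moment :: "real \<Rightarrow> vertex list set set \<Rightarrow> real" where
  "rel_second_moment q D =
     (\<Sum>d\<in>D. \<Sum>d'\<in>D. q ^ card (path_edges d \<inter> path_edges d')) / real (card D) ^ 2"

lemma integrable_hc_law [simp]: "integrable (measure_pmf (hc_law n p)) (f :: edge set \<Rightarrow> real)"
  by (rule integrable_measure_pmf_finite) simp

lemma path_count_eq_sum:
  "finite D \<Longrightarrow> real (path_count D E) = (\<Sum>d\<in>D. indicator {E. path_edges d \<subseteq> E} E)"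
  by (simp add: path_count_def indicator_def sum.If_cases Int_def)

context
  fixes n :: nat and p :: real and D :: "vertex list set set"
  assumes D: "D \<subseteq> diam_paths n" "D \<noteq> {}" and p: "0 \<le> p" "p \<le> 1"
begin

lemma finite_paths: "finite D"
  using D finite_diam_paths finite_subset by blast

lemma card_paths_pos: "card D > 0"
  using D finite_paths by (simp add: card_gt_0_iff)

text \<open>The identity for adjoining one path, summed over \<open>D\<close>; each path has exactly
  \<open>n\<close> edges. No division by the mean occurs, so the case p = 0 is included and the mean
  itself is read off at \<open>A = UNIV\<close>.\<close>

lemma expectation_path_count_indicator:
  "measure_pmf.expectation (hc_law n p) (\<lambda>E. indicator A E * real (path_count D E)) =
     real (card D) * p ^ n * measure_pmf.prob (tamper (hc_law n p) D) A"
proof -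
  have "measure_pmf.expectation (hc_law n p) (\<lambda>E. indicator A E * real (path_count D E)) =
      measure_pmf.expectation (hc_law n p) (\<lambda>E. \<Sum>d\<in>D. indicator {E \<in> A. path_edges d \<subseteq> E} E)"
    unfolding path_count_eq_sum[OF finite_paths] sum_distrib_left
    by (intro Bochner_Integration.integral_cong refl sum.cong) (auto simp: indicator_def)
  also have "\<dots> = (\<Sum>d\<in>D. measure_pmf.prob (hc_law n p) {E \<in> A. path_edges d \<subseteq> E})"
    by (subst Bochner_Integration.integral_sum) auto
  also have "\<dots> = (\<Sum>d\<in>D. p ^ n * measure_pmf.prob (hc_law n p) {E. E \<union> path_edges d \<in> A})"
  proof (rule sum.cong[OF refl])
    fix d assume "d \<in> D"
    hence d: "d \<in> diam_paths n" using D by auto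
    show "measure_pmf.prob (hc_law n p) {E \<in> A. path_edges d \<subseteq> E} =
        p ^ n * measure_pmf.prob (hc_law n p) {E. E \<union> path_edges d \<in> A}"
      using prob_hc_law_superset[OF path_edges_subset[OF d] p] by (simp add: card_path_edges[OF d])
  qed
  also have "\<dots> = real (card D) * p ^ n * measure_pmf.prob (tamper (hc_law n p) D) A"
    using prob_tamper[OF finite_paths D(2), of "hc_law n p" A] card_paths_pos
    by (simp add: sum_distrib_left[symmetric])
  finally show ?thesis .
qed

lemma expectation_path_count:
  "measure_pmf.expectation (hc_law n p) (\<lambda>E. real (path_count D E)) = real (card D) * p ^ n"
  using expectation_path_count_indicator[of UNIV] by simp

lemma rel_count_eq:
  "rel_count n p D E =
     real (path_count D E) / measure_pmf.expectation (hc_law n p) (\<lambda>E. real (path_count D E))"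
  unfolding expectation_path_count rel_count_def ..

lemma rel_count_nonneg: "rel_count n p D E \<ge> 0"
  using p by (simp add: rel_count_def)

lemma expectation_rel_count_indicator:
  assumes "p > 0"
  shows "measure_pmf.expectation (hc_law n p) (\<lambda>E. indicator A E * rel_count n p D E) =
     measure_pmf.prob (tamper (hc_law n p) D) A"
  using expectation_path_count_indicator[of A] assms card_paths_pos
  by (simp add: rel_count_def)

lemma expectation_rel_count:
  assumes "p > 0"
  shows "measure_pmf.expectation (hc_law n p) (rel_count n p D) = 1"
  using expectation_rel_count_indicator[OF assms, of UNIV] by simp

lemma expectation_rel_count_sq:
  assumes "p > 0"
  shows "measure_pmf.expectation (hc_law n p) (\<lambda>E. rel_count n p D E ^ 2) = rel_second_moment (1 / p) D"
proof -
  have "measure_pmf.expectation (hc_law n p) (\<lambda>E. real (path_count D E) ^ 2) =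
      measure_pmf.expectation (hc_law n p)
        (\<lambda>E. \<Sum>d\<in>D. \<Sum>d'\<in>D. indicator {E. path_edges d \<union> path_edges d' \<subseteq> E} E)"
    unfolding path_count_eq_sum[OF finite_paths] power2_eq_square sum_product
    by (intro Bochner_Integration.integral_cong refl sum.cong) (auto simp: indicator_def)
  also have "\<dots> = (\<Sum>d\<in>D. \<Sum>d'\<in>D. measure_pmf.prob (hc_law n p) {E. path_edges d \<union> path_edges d' \<subseteq> E})"
    by (simp add: Bochner_Integration.integral_sum del: Un_subset_iff)
  also have "\<dots> = (\<Sum>d\<in>D. \<Sum>d'\<in>D. (p ^ n) ^ 2 * (1 / p) ^ card (path_edges d \<inter> path_edges d'))"
  proof (intro sum.cong refl)
    fix d d' assume "d \<in> D" "d' \<in> D"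
    hence d: "d \<in> diam_paths n" "d' \<in> diam_paths n" using D by auto
    note sub = path_edges_subset[OF d(1)] path_edges_subset[OF d(2)]
    have fin: "finite (path_edges d)" "finite (path_edges d')"
      using sub finite_hc_edges finite_subset by blast+
    \<comment> \<open>Two paths have 2 n edges counted with multiplicity, so the exponent for their
      union is 2 n minus the overlap.\<close>
    have "card (path_edges d \<union> path_edges d') + card (path_edges d \<inter> path_edges d') = n + n"
      using card_Un_Int[OF fin] card_path_edges[OF d(1)] card_path_edges[OF d(2)] by simp
    hence "p ^ card (path_edges d \<union> path_edges d') * p ^ card (path_edges d \<inter> path_edges d') = (p ^ n) ^ 2"
      by (metis power_add power2_eq_square)
    hence "p ^ card (path_edges d \<union> path_edges d') = (p ^ n) ^ 2 * (1 / p) ^ card (path_edges d \<inter> path_edges d')"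
      using assms by (simp add: field_simps power_divide)
    thus "measure_pmf.prob (hc_law n p) {E. path_edges d \<union> path_edges d' \<subseteq> E} =
        (p ^ n) ^ 2 * (1 / p) ^ card (path_edges d \<inter> path_edges d')"
      using prob_hc_law_contains[of "path_edges d \<union> path_edges d'" n p] sub p by simp
  qed
  finally have "measure_pmf.expectation (hc_law n p) (\<lambda>E. real (path_count D E) ^ 2) =
      (p ^ n) ^ 2 * (\<Sum>d\<in>D. \<Sum>d'\<in>D. (1 / p) ^ card (path_edges d \<inter> path_edges d'))"
    by (simp add: sum_distrib_left)
  thus ?thesis
    using assms card_paths_pos
    by (simp add: rel_count_def rel_second_moment_def power_divide power_mult_distrib field_simps)
qed

text \<open>With \<open>X\<close> denoting the relative count, P A - Q A is the mean of 1 - X over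
  \<open>A\<close>, hence at most that of its positive part. The other sign follows by passing to
  the complement of \<open>A\<close>.\<close>

lemma tv_dist_le_expectation:
  assumes "p > 0"
  shows "tv_dist n (hc_law n p) (tamper (hc_law n p) D) \<le>
     measure_pmf.expectation (hc_law n p) (\<lambda>E. max 0 (1 - rel_count n p D E))"
proof -
  let ?P = "measure_pmf.prob (hc_law n p)"
  let ?Q = "measure_pmf.prob (tamper (hc_law n p) D)"
  let ?X = "rel_count n p D"
  let ?e = "measure_pmf.expectation (hc_law n p) (\<lambda>E. max 0 (1 - ?X E))"
  have le: "?P A - ?Q A \<le> ?e" for A
  proof -
    have "?P A - ?Q A = measure_pmf.expectation (hc_law n p) (indicator A) -
        measure_pmf.expectation (hc_law n p) (\<lambda>E. indicator A E * ?X E)"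
      by (simp add: expectation_rel_count_indicator[OF assms])
    also have "\<dots> = measure_pmf.expectation (hc_law n p) (\<lambda>E. indicator A E - indicator A E * ?X E)"
      by (rule Bochner_Integration.integral_diff[symmetric]) simp_all
    also have "\<dots> \<le> ?e"
      by (intro integral_mono) (auto simp: indicator_def)
    finally show ?thesis .
  qed
  have "\<bar>?P A - ?Q A\<bar> \<le> ?e" for A
  proof -
    have "?P (- A) = 1 - ?P A" "?Q (- A) = 1 - ?Q A"
      using measure_pmf.prob_compl[of A "hc_law n p"]
        measure_pmf.prob_compl[of A "tamper (hc_law n p) D"] by (simp_all add: Compl_eq_Diff_UNIV)
    thus ?thesis using le[of A] le[of "- A"] by linarith
  qed
  thus ?thesis unfolding tv_dist_def
    by (subst Max_le_iff) (auto intro!: finite_imageI finite_Pow_edge_configs simp del: finite_Pow_iff)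
qed

text \<open>A quadratic majorant suffices for every later estimate, because the mean of the relative
  count is 1 and its second moment is known.\<close>

lemma expectation_le_second_moment:
  assumes "p > 0" "\<And>x. x \<ge> 0 \<Longrightarrow> f x \<le> a + b * x + c * x ^ 2"
  shows "measure_pmf.expectation (hc_law n p) (\<lambda>E. f (rel_count n p D E)) \<le>
     a + b + c * rel_second_moment (1 / p) D"
proof -
  have "measure_pmf.expectation (hc_law n p) (\<lambda>E. f (rel_count n p D E)) \<le>
      measure_pmf.expectation (hc_law n p)
        (\<lambda>E. a + b * rel_count n p D E + c * rel_count n p D E ^ 2)"
    by (intro integral_mono assms(2) rel_count_nonneg) simp_all
  also have "\<dots> = a + b + c * rel_second_moment (1 / p) D"
    using expectation_rel_count[OF assms(1)] expectation_rel_count_sq[OF assms(1)]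
    by simp
  finally show ?thesis .
qed

text \<open>The majorant t + (1 - x) ^ 2 / (4 t) of \<bar>1 - x\<bar> comes from the inequality of
  arithmetic and geometric means; the parameter t is adapted to the variance later.\<close>

lemma tv_dist_le_AMGM:
  assumes "p > 0" "t > 0"
  shows "tv_dist n (hc_law n p) (tamper (hc_law n p) D) \<le>
     t + (rel_second_moment (1 / p) D - 1) / (4 * t)"
proof -
  have "max 0 (1 - x) \<le> (t + 1 / (4 * t)) + (- 1 / (2 * t)) * x + (1 / (4 * t)) * x ^ 2" for x
  proof -
    have "(t + 1 / (4 * t)) + (- 1 / (2 * t)) * x + (1 / (4 * t)) * x ^ 2 = t + (1 - x) ^ 2 / (4 * t)"
      using assms(2) by (simp add: field_simps power2_eq_square)
    moreover have "t + (1 - x) ^ 2 / (4 * t) - (1 - x) = (2 * t - (1 - x)) ^ 2 / (4 * t)"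
      using assms(2) by (simp add: field_simps power2_eq_square)
    moreover have "(2 * t - (1 - x)) ^ 2 / (4 * t) \<ge> 0" "(1 - x) ^ 2 / (4 * t) \<ge> 0"
      using assms(2) by simp_all
    ultimately show ?thesis using assms(2) by linarith
  qed
  from order_trans[OF tv_dist_le_expectation[OF assms(1)]
      expectation_le_second_moment[OF assms(1), of "\<lambda>x. max 0 (1 - x)", OF this]]
  have "tv_dist n (hc_law n p) (tamper (hc_law n p) D) \<le>
      (t + 1 / (4 * t)) + - 1 / (2 * t) + 1 / (4 * t) * rel_second_moment (1 / p) D" .
  also have "\<dots> = t + (rel_second_moment (1 / p) D - 1) / (4 * t)"
    using assms(2) by (simp add: field_simps)
  finally show ?thesis .
qed

text \<open>A bounded second moment prevents the density, whose mean is 1, from concentrating near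
  0. The majorant is the square of 1 - x / (2 C): its slope at 0 is - 1 / C, which is at least - 1
  for C \<ge> 1, so it stays above 1 - x. Its mean is at most 1 - 1 / C + 1 / (4 C).\<close>

lemma tv_dist_le_second_moment:
  assumes "p > 0" "rel_second_moment (1 / p) D \<le> C" "C \<ge> 1"
  shows "tv_dist n (hc_law n p) (tamper (hc_law n p) D) \<le> 1 - 3 / (4 * C)"
proof -
  have "max 0 (1 - x) \<le> 1 + (- 1 / C) * x + (1 / (4 * C ^ 2)) * x ^ 2" if "x \<ge> 0" for x
  proof -
    have "x / C \<le> x" using assms(3) that by (simp add: divide_le_eq mult_le_cancel_left1)
    moreover have "1 + (- 1 / C) * x + (1 / (4 * C ^ 2)) * x ^ 2 = (1 - x / (2 * C)) ^ 2"
      using assms(3) by (simp add: field_simps power2_eq_square)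
    moreover have "(1 / (4 * C ^ 2)) * x ^ 2 \<ge> 0" by simp
    moreover have "(1 - x / (2 * C)) ^ 2 \<ge> 0" by simp
    moreover have "(- 1 / C) * x = - (x / C)" by simp
    ultimately show ?thesis by (intro max.boundedI) linarith+
  qed
  from order_trans[OF tv_dist_le_expectation[OF assms(1)]
      expectation_le_second_moment[OF assms(1), of "\<lambda>x. max 0 (1 - x)", OF this]]
  have "tv_dist n (hc_law n p) (tamper (hc_law n p) D) \<le>
      1 + - 1 / C + 1 / (4 * C ^ 2) * rel_second_moment (1 / p) D" by simp
  also have "\<dots> \<le> 1 + - 1 / C + 1 / (4 * C ^ 2) * C"
    using assms by (intro add_left_mono mult_left_mono) auto
  also have "\<dots> = 1 - 3 / (4 * C)"
    using assms by (simp add: field_simps power2_eq_square)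
  finally show ?thesis .
qed

text \<open>Chebyshev's inequality: the mean is 1, so subtracting 1 from the second moment gives the
  variance.\<close>

lemma prob_deviation_le:
  assumes "p > 0" "\<epsilon> > 0"
  shows "measure_pmf.prob (hc_law n p) {E. \<bar>rel_count n p D E - 1\<bar> > \<epsilon>} \<le>
     (rel_second_moment (1 / p) D - 1) / \<epsilon> ^ 2"
proof -
  have "indicator {x. \<bar>x - 1\<bar> > \<epsilon>} x \<le> 1 / \<epsilon> ^ 2 + (- 2 / \<epsilon> ^ 2) * x + (1 / \<epsilon> ^ 2) * x ^ 2" for x :: real
  proof -
    have "1 / \<epsilon> ^ 2 + (- 2 / \<epsilon> ^ 2) * x + (1 / \<epsilon> ^ 2) * x ^ 2 = (x - 1) ^ 2 / \<epsilon> ^ 2"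
      using assms(2) by (simp add: field_simps power2_eq_square)
    moreover have "1 \<le> (x - 1) ^ 2 / \<epsilon> ^ 2" if "\<bar>x - 1\<bar> > \<epsilon>"
    proof -
      have "\<epsilon> ^ 2 \<le> \<bar>x - 1\<bar> ^ 2" using that assms(2) by (intro power_mono) auto
      thus ?thesis using assms(2) by simp
    qed
    ultimately show ?thesis by (auto simp: indicator_def)
  qed
  from expectation_le_second_moment[OF assms(1), of "indicator {x. \<bar>x - 1\<bar> > \<epsilon>}", OF this]
  have "measure_pmf.expectation (hc_law n p) (\<lambda>E. indicator {x. \<bar>x - 1\<bar> > \<epsilon>} (rel_count n p D E)) \<le>
      (rel_second_moment (1 / p) D - 1) / \<epsilon> ^ 2"
    using assms(2) by (simp add: diff_divide_distrib)
  also have "(\<lambda>E. indicator {x. \<bar>x - 1\<bar> > \<epsilon>} (rel_count n p D E) :: real) =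
      indicator {E. \<bar>rel_count n p D E - 1\<bar> > \<epsilon>}"
    by (auto simp: indicator_def fun_eq_iff)
  finally show ?thesis by simp
qed

section \<open>Configurations without a path\<close>

lemma prob_path_count_pos_le:
  "measure_pmf.prob (hc_law n p) {E. path_count D E \<noteq> 0} \<le> real (card D) * p ^ n"
proof -
  have "measure_pmf.prob (hc_law n p) {E. path_count D E \<noteq> 0} =
      measure_pmf.expectation (hc_law n p) (indicator {E. path_count D E \<noteq> 0})" by simp
  also have "\<dots> \<le> measure_pmf.expectation (hc_law n p) (\<lambda>E. real (path_count D E))"
    by (intro integral_mono) (auto simp: indicator_def)
  finally show ?thesis by (simp add: expectation_path_count)
qed

lemma prob_no_path: "measure_pmf.prob (hc_law n p) {E. path_count D E = 0} =
    1 - measure_pmf.prob (hc_law n p) {E. path_count D E \<noteq> 0}"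
  using measure_pmf.prob_compl[of "{E. path_count D E \<noteq> 0}" "hc_law n p"]
  by (simp add: Compl_eq_Diff_UNIV[symmetric] Collect_neg_eq[symmetric])

lemma prob_tamper_no_path: "measure_pmf.prob (tamper (hc_law n p) D) {E. path_count D E = 0} = 0"
proof -
  have "{E. E \<union> path_edges d \<in> {E. path_count D E = 0}} = {}" if "d \<in> D" for d
    using that finite_paths by (auto simp: path_count_def)
  hence "(\<Sum>d\<in>D. measure_pmf.prob (hc_law n p) {E. E \<union> path_edges d \<in> {E. path_count D E = 0}}) = 0"
    by (intro sum.neutral) (metis measure_empty)
  thus ?thesis
    unfolding prob_tamper[OF finite_paths D(2) finite_set_pmf_hc_law] by (simp only: div_0)
qed

text \<open>The absence of paths is the distinguishing event, since a tampered configuration always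
  contains the planted path.\<close>

lemma tv_dist_ge_no_path:
  "measure_pmf.prob (hc_law n p) {E. path_count D E = 0} \<le>
     tv_dist n (hc_law n p) (tamper (hc_law n p) D)"
proof -
  \<comment> \<open>The maximum in \<open>tv_dist\<close> runs over sets of configurations only, so
    the event is cut down to these.\<close>
  define A where "A = {E. path_count D E = 0} \<inter> edge_configs n"
  have "measure_pmf.prob (hc_law n p) {E. path_count D E = 0} = measure_pmf.prob (hc_law n p) A"
    using set_pmf_edge_law[of "hc_edges n" p]
    by (intro prob_cong_set_pmf) (auto simp: A_def edge_configs_def hc_law_eq_edge_law)
  moreover have "measure_pmf.prob (tamper (hc_law n p) D) A \<le> 0"
    unfolding prob_tamper_no_path[symmetric]
    by (intro measure_pmf.finite_measure_mono) (auto simp: A_def)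
  hence "measure_pmf.prob (hc_law n p) A \<le>
      \<bar>measure_pmf.prob (hc_law n p) A - measure_pmf.prob (tamper (hc_law n p) D) A\<bar>" by linarith
  moreover have "\<dots> \<le> tv_dist n (hc_law n p) (tamper (hc_law n p) D)"
    unfolding tv_dist_def
    by (intro Max_ge) (auto simp: A_def simp del: finite_Pow_iff intro!: finite_imageI finite_Pow_edge_configs)
  ultimately show ?thesis by linarith
qed

end

lemma tv_dist_nonneg: "tv_dist n P Q \<ge> 0"
proof -
  have "\<bar>measure_pmf.prob P {} - measure_pmf.prob Q {}\<bar> \<le> tv_dist n P Q"
    unfolding tv_dist_def
    by (intro Max_ge imageI[where f = "\<lambda>A. \<bar>measure_pmf.prob P A - measure_pmf.prob Q A\<bar>"]) (auto intro!: finite_imageI finite_Pow_edge_configs simp del: finite_Pow_iff)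
  thus ?thesis by simp
qed

lemma tv_dist_le_1: "tv_dist n P Q \<le> 1"
proof -
  have "\<bar>measure_pmf.prob P A - measure_pmf.prob Q A\<bar> \<le> 1" for A
    using measure_pmf.prob_le_1[of P A] measure_pmf.prob_le_1[of Q A]
      measure_nonneg[of "measure_pmf P" A] measure_nonneg[of "measure_pmf Q" A] by linarith
  thus ?thesis unfolding tv_dist_def
    by (subst Max_le_iff) (auto intro!: finite_imageI finite_Pow_edge_configs simp del: finite_Pow_iff)
qed

section \<open>Asymptotics\<close>

text \<open>Serves both families, all paths and those from 0. The constraint on \<open>p n\<close>
  starts at n = 1, which is why the eventual statements are combined with n \<ge> 1.\<close>

locale planted_paths =
  fixes p :: "nat \<Rightarrow> real" and D :: "nat \<Rightarrow> vertex list set set"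
  assumes p01: "\<And>n. n \<ge> 1 \<Longrightarrow> 0 \<le> p n \<and> p n \<le> 1"
    and D: "\<And>n. D n \<subseteq> diam_paths n" "\<And>n. D n \<noteq> {}"
begin

abbreviation "Q n \<equiv> hc_law n (p n)"
abbreviation "Qtam n \<equiv> tamper (hc_law n (p n)) (D n)"
abbreviation "N n \<equiv> path_count (D n)"

lemma prob_no_path_tendsto_1:
  assumes "(\<lambda>n. real (card (D n)) * p n ^ n) \<longlonglongrightarrow> 0"
  shows "(\<lambda>n. measure_pmf.prob (Q n) {E. N n E = 0}) \<longlonglongrightarrow> 1"
proof (rule tendsto_sandwich)
  show "\<forall>\<^sub>F n in sequentially. 1 - real (card (D n)) * p n ^ n \<le> measure_pmf.prob (Q n) {E. N n E = 0}"
    using eventually_ge_at_top[of 1]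
  proof eventually_elim
    case (elim n)
    hence pn: "0 \<le> p n" "p n \<le> 1" using p01 by auto
    show ?case using prob_path_count_pos_le[OF D pn] prob_no_path[OF D pn] by simp
  qed
  show "(\<lambda>n. 1 - real (card (D n)) * p n ^ n) \<longlonglongrightarrow> 1"
    using tendsto_diff[OF tendsto_const assms, of 1] by simp
qed auto

lemma detectable_if_expectation_tendsto_0:
  assumes "(\<lambda>n. real (card (D n)) * p n ^ n) \<longlonglongrightarrow> 0"
  shows "detectable Q Qtam"
  unfolding detectable_def
proof (rule tendsto_sandwich[OF _ _ prob_no_path_tendsto_1[OF assms] tendsto_const])
  show "\<forall>\<^sub>F n in sequentially. measure_pmf.prob (Q n) {E. N n E = 0} \<le> tv_dist n (Q n) (Qtam n)"
    using eventually_ge_at_top[of 1]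
    by eventually_elim (use p01 in \<open>auto intro!: tv_dist_ge_no_path[OF D]\<close>)
  show "\<forall>\<^sub>F n in sequentially. tv_dist n (Q n) (Qtam n) \<le> 1"
    by (simp add: tv_dist_le_1)
qed

lemma converges_to_delta0_if_expectation_tendsto_0:
  assumes "(\<lambda>n. real (card (D n)) * p n ^ n) \<longlonglongrightarrow> 0"
  shows "converges_to_delta0 Q N"
proof -
  have cdf: "cdf (distr (measure_pmf (Q n)) borel (\<lambda>E. real (N n E))) x =
      measure_pmf.prob (Q n) {E. real (N n E) \<le> x}" for n x
    unfolding cdf_def by (subst measure_distr) (auto simp: vimage_def)
  \<comment> \<open>The convergence holds at every x, even at the jump 0: the counts are nonnegative
    and the mass arrives exactly at 0.\<close>
  have "(\<lambda>n. cdf (distr (measure_pmf (Q n)) borel (\<lambda>E. real (N n E))) x) \<longlonglongrightarrow> cdf (return borel 0) x" for x :: real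
  proof (cases "x < 0")
    case True
    have "{E. real (N n E) \<le> x} = {}" for n using True by (auto simp: not_le intro: less_le_trans)
    with True show ?thesis
      unfolding cdf by (simp add: cdf_def measure_return)
  next
    case False
    have "(\<lambda>n. measure_pmf.prob (Q n) {E. real (N n E) \<le> x}) \<longlonglongrightarrow> 1"
    proof (rule tendsto_sandwich[OF _ _ prob_no_path_tendsto_1[OF assms] tendsto_const])
      show "\<forall>\<^sub>F n in sequentially. measure_pmf.prob (Q n) {E. N n E = 0} \<le>
          measure_pmf.prob (Q n) {E. real (N n E) \<le> x}"
        using False by (intro always_eventually allI measure_pmf.finite_measure_mono) auto
    qed auto
    with False show ?thesis
      unfolding cdf by (simp add: cdf_def measure_return)
  qed
  thus ?thesis
    unfolding converges_to_delta0_def weak_conv_m_def weak_conv_def by blast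
qed

lemma strongly_undetectable_if_second_moment:
  assumes "\<forall>\<^sub>F n in sequentially. p n > 0 \<and> rel_second_moment (1 / p n) (D n) \<le> 1 + u n"
    and "u \<longlonglongrightarrow> 0"
  shows "strongly_undetectable Q Qtam"
  unfolding strongly_undetectable_def
proof (rule order_tendstoI)
  fix a :: real assume "a > 0"
  hence "\<forall>\<^sub>F n in sequentially. u n < a ^ 2" using order_tendstoD(2)[OF assms(2)] by simp
  with assms(1) eventually_ge_at_top[of 1]
  show "\<forall>\<^sub>F n in sequentially. tv_dist n (Q n) (Qtam n) < a"
  proof eventually_elim
    case (elim n)
    \<comment> \<open>The choice t = a / 2 balances the two terms: a variance below a ^ 2 makes the
      second one smaller than a / 2.\<close>
    have "tv_dist n (Q n) (Qtam n) \<le> a / 2 + (rel_second_moment (1 / p n) (D n) - 1) / (4 * (a / 2))"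
      using elim p01[of n] \<open>a > 0\<close> by (intro tv_dist_le_AMGM D) auto
    also have "\<dots> < a / 2 + a ^ 2 / (4 * (a / 2))"
      using elim \<open>a > 0\<close> by (intro add_strict_left_mono divide_strict_right_mono) auto
    also have "\<dots> = a" using \<open>a > 0\<close> by (simp add: field_simps power2_eq_square)
    finally show ?case .
  qed
next
  fix a :: real assume "a < 0"
  thus "\<forall>\<^sub>F n in sequentially. a < tv_dist n (Q n) (Qtam n)"
    using tv_dist_nonneg by (intro always_eventually allI) (rule less_le_trans)
qed

lemma weak_law_if_second_moment:
  assumes "\<forall>\<^sub>F n in sequentially. p n > 0 \<and> rel_second_moment (1 / p n) (D n) \<le> 1 + u n"
    and "u \<longlonglongrightarrow> 0"
  shows "weak_law_large_numbers Q N"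
  unfolding weak_law_large_numbers_def
proof (intro allI impI)
  fix \<epsilon> :: real assume \<epsilon>: "\<epsilon> > 0"
  show "(\<lambda>n. measure_pmf.prob (Q n) {E. \<epsilon> < \<bar>real (N n E) /
      measure_pmf.expectation (Q n) (\<lambda>E. real (N n E)) - 1\<bar>}) \<longlonglongrightarrow> 0"
  proof (rule tendsto_sandwich[OF _ _ tendsto_const])
    show "\<forall>\<^sub>F n in sequentially. measure_pmf.prob (Q n) {E. \<epsilon> < \<bar>real (N n E) /
        measure_pmf.expectation (Q n) (\<lambda>E. real (N n E)) - 1\<bar>} \<le> u n / \<epsilon> ^ 2"
      using assms(1) eventually_ge_at_top[of 1]
    proof eventually_elim
      case (elim n)
      hence pn: "0 \<le> p n" "p n \<le> 1" using p01 by auto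
      have "measure_pmf.prob (Q n) {E. \<epsilon> < \<bar>rel_count n (p n) (D n) E - 1\<bar>} \<le>
          (rel_second_moment (1 / p n) (D n) - 1) / \<epsilon> ^ 2"
        using elim pn \<epsilon> by (intro prob_deviation_le D) auto
      also have "\<dots> \<le> u n / \<epsilon> ^ 2" using elim by (intro divide_right_mono) auto
      finally show ?case unfolding rel_count_eq[OF D pn] .
    qed
    show "(\<lambda>n. u n / \<epsilon> ^ 2) \<longlonglongrightarrow> 0" using tendsto_divide_zero[OF assms(2)] .
  qed simp
qed

lemma not_weak_law_if_no_path:
  assumes "\<delta> > 0" "\<forall>\<^sub>F n in sequentially. \<delta> \<le> measure_pmf.prob (Q n) {E. N n E = 0}"
  shows "\<not> weak_law_large_numbers Q N"
proof
  assume "weak_law_large_numbers Q N"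
  hence "(\<lambda>n. measure_pmf.prob (Q n) {E. \<bar>real (N n E) /
      measure_pmf.expectation (Q n) (\<lambda>E. real (N n E)) - 1\<bar> > 1 / 2}) \<longlonglongrightarrow> 0"
    unfolding weak_law_large_numbers_def by (meson half_gt_zero zero_less_one)
  hence "\<forall>\<^sub>F n in sequentially. measure_pmf.prob (Q n) {E. \<bar>real (N n E) /
      measure_pmf.expectation (Q n) (\<lambda>E. real (N n E)) - 1\<bar> > 1 / 2} < \<delta>"
    using assms(1) by (rule order_tendstoD(2))
  with assms(2) have "\<forall>\<^sub>F n in sequentially. False"
  proof eventually_elim
    case (elim n)
    \<comment> \<open>Where the count vanishes, the quotient is 0 whatever its denominator, and the
      deviation 1 exceeds 1 / 2.\<close>
    have "measure_pmf.prob (Q n) {E. N n E = 0} \<le> measure_pmf.prob (Q n) {E. \<bar>real (N n E) /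
        measure_pmf.expectation (Q n) (\<lambda>E. real (N n E)) - 1\<bar> > 1 / 2}"
      by (intro measure_pmf.finite_measure_mono) auto
    with elim show ?case by linarith
  qed
  thus False by simp
qed

lemma weakly_undetectable_if_bounded:
  assumes "\<forall>\<^sub>F n in sequentially. p n > 0 \<and> rel_second_moment (1 / p n) (D n) \<le> C" "C \<ge> 1"
    and "\<delta> > 0" "\<forall>\<^sub>F n in sequentially. \<delta> \<le> measure_pmf.prob (Q n) {E. N n E = 0}"
  shows "weakly_undetectable Q Qtam"
proof -
  define \<epsilon> where "\<epsilon> = min \<delta> (3 / (4 * C))"
  have "\<epsilon> > 0" using assms by (simp add: \<epsilon>_def)
  moreover have "\<forall>\<^sub>F n in sequentially. \<epsilon> \<le> tv_dist n (Q n) (Qtam n) \<and> tv_dist n (Q n) (Qtam n) \<le> 1 - \<epsilon>"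
    using assms(1,4) eventually_ge_at_top[of 1]
  proof eventually_elim
    case (elim n)
    hence pn: "0 \<le> p n" "p n \<le> 1" using p01 by auto
    have "tv_dist n (Q n) (Qtam n) \<le> 1 - 3 / (4 * C)"
      using elim assms(2) by (intro tv_dist_le_second_moment[OF D pn]) auto
    moreover have "measure_pmf.prob (Q n) {E. N n E = 0} \<le> tv_dist n (Q n) (Qtam n)"
      by (rule tv_dist_ge_no_path[OF D pn])
    moreover have "\<epsilon> \<le> \<delta>" "\<epsilon> \<le> 3 / (4 * C)" by (simp_all add: \<epsilon>_def)
    ultimately show ?case using elim by linarith
  qed
  ultimately show ?thesis unfolding weakly_undetectable_def by blast
qed

end

section \<open>Moments in the different regimes of \<open>p\<close>\<close>

lemma power_mult_geometric_tendsto_0: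
  fixes x :: real
  assumes "0 \<le> x" "x < 1" "k \<ge> 1"
  shows "(\<lambda>n. real n ^ k * x ^ n) \<longlonglongrightarrow> 0"
proof -
  \<comment> \<open>The sequence is the k-th power of n y ^ n, which reduces the claim to the case k
    = 1.\<close>
  define y where "y = root k x"
  have y: "0 \<le> y" "y < 1" "y ^ k = x"
    using assms by (auto simp: y_def real_root_lt_1_iff)
  have "(\<lambda>n. real n * y ^ n) \<longlonglongrightarrow> 0" using y by (intro powser_times_n_limit_0) auto
  hence "(\<lambda>n. (real n * y ^ n) ^ k) \<longlonglongrightarrow> 0 ^ k" by (rule tendsto_power)
  moreover have "(real n * y ^ n) ^ k = real n ^ k * x ^ n" for n
    by (simp add: y(3)[symmetric] power_mult_distrib power_mult[symmetric] mult.commute)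
  moreover have "0 ^ k = (0 :: real)" using assms(3) by simp
  ultimately show ?thesis by simp
qed

lemma fact_mult_power_tendsto_0:
  assumes "0 \<le> c" "c < exp 1"
  shows "(\<lambda>n. fact n * (c / real n) ^ n) \<longlonglongrightarrow> 0"
proof (rule tendsto_sandwich[OF _ _ tendsto_const])
  show "\<forall>\<^sub>F n in sequentially. fact n * (c / real n) ^ n \<le> exp 1 * (real n ^ 1 * (c / exp 1) ^ n)"
    using eventually_ge_at_top[of 1]
  proof eventually_elim
    case (elim n)
    have "fact n * (c / real n) ^ n \<le> exp 1 * real n * (real n / exp 1) ^ n * (c / real n) ^ n"
      using elim assms by (intro mult_right_mono fact_le_stirling) auto
    also have "(real n / exp 1) ^ n * (c / real n) ^ n = (c / exp 1) ^ n"
      using elim by (simp add: power_mult_distrib[symmetric])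
    hence "exp 1 * real n * (real n / exp 1) ^ n * (c / real n) ^ n = exp 1 * (real n ^ 1 * (c / exp 1) ^ n)"
      by simp
    finally show ?case .
  qed
  show "(\<lambda>n. exp 1 * (real n ^ 1 * (c / exp 1) ^ n)) \<longlonglongrightarrow> 0"
    using assms by (intro tendsto_mult_right_zero power_mult_geometric_tendsto_0) auto
qed (use assms in auto)

text \<open>The base \<open>b\<close> is 2 if the start is free and 1 if it is 0; by the Stirling
  bound the expected count decays geometrically, up to a factor n, once b \<gamma> < e.\<close>

lemma expectation_diam_paths_tendsto_0:
  fixes p :: "nat \<Rightarrow> real"
  assumes p01: "\<And>n. n \<ge> 1 \<Longrightarrow> 0 \<le> p n \<and> p n \<le> 1"
    and "\<And>n. n \<ge> 1 \<Longrightarrow> real (card (D n)) \<le> b ^ n * fact n" "b > 0"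
    and "\<gamma> < exp 1 / b" "\<forall>\<^sub>F n in sequentially. p n \<le> \<gamma> / real n"
  shows "(\<lambda>n. real (card (D n)) * p n ^ n) \<longlonglongrightarrow> 0"
proof (rule tendsto_sandwich[OF _ _ tendsto_const])
  \<comment> \<open>The maximum keeps the base of the power nonnegative for negative
    \<gamma>.\<close>
  define c where "c = b * max 0 \<gamma>"
  show "\<forall>\<^sub>F n in sequentially. 0 \<le> real (card (D n)) * p n ^ n"
    using eventually_ge_at_top[of 1] by eventually_elim (use p01 in auto)
  show "\<forall>\<^sub>F n in sequentially. real (card (D n)) * p n ^ n \<le> fact n * (c / real n) ^ n"
    using assms(5) eventually_ge_at_top[of 1]
  proof eventually_elim
    case (elim n)
    have "p n \<le> max 0 \<gamma> / real n"
      using elim by (meson divide_right_mono max.cobounded2 of_nat_0_le_iff order_trans)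
    hence "real (card (D n)) * p n ^ n \<le> (b ^ n * fact n) * (max 0 \<gamma> / real n) ^ n"
      using assms(2,3) elim p01 by (intro mult_mono power_mono) auto
    also have "\<dots> = fact n * (c / real n) ^ n"
      by (simp add: c_def power_mult_distrib power_divide)
    finally show ?case .
  qed
  have "c < exp 1" using assms(3,4) by (auto simp: c_def max_def field_simps)
  thus "(\<lambda>n. fact n * (c / real n) ^ n) \<longlonglongrightarrow> 0"
    using assms(3) by (intro fact_mult_power_tendsto_0) (auto simp: c_def)
qed

lemma sum_geometric_le:
  fixes x :: real
  assumes "0 \<le> x" "x < 1"
  shows "(\<Sum>m=1..n. x ^ m) \<le> x / (1 - x)"
proof -
  have "(\<Sum>m=1..n. x ^ m) = x * (\<Sum>m<n. x ^ m)"
    by (simp add: sum_distrib_left sum.atLeast1_atMost_eq)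
  also have "(\<Sum>m<n. x ^ m) = (1 - x ^ n) / (1 - x)"
    using assms by (simp add: sum_gp_strict)
  also have "x * \<dots> \<le> x * (1 / (1 - x))"
    using assms by (intro mult_left_mono divide_right_mono) auto
  finally show ?thesis by simp
qed

lemma rel_second_moment_diam_paths0_le:
  assumes "n \<ge> 1" "q \<ge> 1"
  shows "rel_second_moment q (diam_paths0 n) \<le> overlap_sum q n / fact n"
proof -
  have "rel_second_moment q (diam_paths0 n) \<le> fact n * overlap_sum q n / fact n ^ 2"
    unfolding rel_second_moment_def card_diam_paths0[OF assms(1)]
    using sum_overlap_diam_paths0[OF assms] by (simp add: divide_right_mono)
  thus ?thesis by (simp add: power2_eq_square)
qed

text \<open>The leading 1 counts all pairs of oriented walks. The pairs with a prescribed shared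
  edge have lost the choice of one start, hence the factor (1 / 2) ^ n.\<close>

lemma rel_second_moment_diam_paths_le:
  assumes "n \<ge> 1" "q \<ge> 1"
  shows "rel_second_moment q (diam_paths n) \<le>
     1 + 2 * real n ^ 2 * (1 / 2) ^ n * (overlap_sum q n / fact n)"
proof -
  define W :: real where "W = 2 ^ n * fact n"
  have W: "W > 0" by (simp add: W_def)
  have "4 * real (card (diam_paths n)) ^ 2 = W ^ 2"
    using arg_cong[OF card_diam_paths[OF assms(1)], of "\<lambda>x. x ^ 2"]
    by (simp add: W_def power_mult_distrib)
  hence "rel_second_moment q (diam_paths n) =
     4 * (\<Sum>d\<in>diam_paths n. \<Sum>d'\<in>diam_paths n. q ^ card (path_edges d \<inter> path_edges d')) / W ^ 2"
    unfolding rel_second_moment_def by (metis mult_divide_mult_cancel_left zero_neq_numeral)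
  also have "\<dots> \<le> W * (W + 2 * real n ^ 2 * overlap_sum q n) / W ^ 2"
    using sum_overlap_diam_paths[OF assms] by (intro divide_right_mono) (simp_all add: W_def)
  also have "\<dots> = 1 + 2 * real n ^ 2 * overlap_sum q n / W"
    using W by (simp add: power2_eq_square field_simps)
  also have "\<dots> = 1 + 2 * real n ^ 2 * (1 / 2) ^ n * (overlap_sum q n / fact n)"
    by (simp add: W_def power_divide)
  finally show ?thesis .
qed

text \<open>The previous estimate is used with n x in the role of \<gamma>; the ratio of the
  geometric sum decreases in this parameter.\<close>

lemma overlap_sum_bound:
  fixes \<delta> :: real
  assumes "\<delta> > 0"
  obtains M where "M \<ge> 1" "\<And>n x \<gamma>. n \<ge> 1 \<Longrightarrow> \<gamma> > 0 \<Longrightarrow> x \<ge> \<gamma> / real n \<Longrightarrow>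
       overlap_sum (1 / x) n / fact n \<le> 1 + M * (\<Sum>m=1..n. (exp 1 * (1 + \<delta>) / \<gamma>) ^ m)"
proof -
  obtain M where M: "M \<ge> 1"
    "\<And>n \<gamma>. \<gamma> > 0 \<Longrightarrow>
       overlap_sum (real n / \<gamma>) n / fact n \<le> 1 + M * (\<Sum>m=1..n. (exp 1 * (1 + \<delta>) / \<gamma>) ^ m)"
    using overlap_sum_le[OF assms] by blast
  have "overlap_sum (1 / x) n / fact n \<le> 1 + M * (\<Sum>m=1..n. (exp 1 * (1 + \<delta>) / \<gamma>) ^ m)"
    if "n \<ge> 1" "\<gamma> > 0" "x \<ge> \<gamma> / real n" for n x \<gamma>
  proof -
    define y where "y = real n * x"
    have y: "y \<ge> \<gamma>" using that by (simp add: y_def field_simps)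
    have "1 / x = real n / y" using that by (simp add: y_def)
    hence "overlap_sum (1 / x) n / fact n \<le> 1 + M * (\<Sum>m=1..n. (exp 1 * (1 + \<delta>) / y) ^ m)"
      using M(2)[of y n] y that by simp
    also have "\<dots> \<le> 1 + M * (\<Sum>m=1..n. (exp 1 * (1 + \<delta>) / \<gamma>) ^ m)"
      using y that M(1) assms
      by (intro add_left_mono mult_left_mono sum_mono power_mono divide_left_mono) auto
    finally show ?thesis .
  qed
  with M(1) that show ?thesis by blast
qed

lemma second_moment_diam_paths:
  fixes p :: "nat \<Rightarrow> real"
  assumes p01: "\<And>n. n \<ge> 1 \<Longrightarrow> 0 \<le> p n \<and> p n \<le> 1"
    and \<gamma>: "\<gamma> > exp 1 / 2" and ev: "\<forall>\<^sub>F n in sequentially. p n \<ge> \<gamma> / real n"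
  obtains u where "u \<longlonglongrightarrow> 0"
    "\<forall>\<^sub>F n in sequentially. p n > 0 \<and> rel_second_moment (1 / p n) (diam_paths n) \<le> 1 + u n"
proof -
  have e: "exp (1::real) > 0" by simp
  have \<gamma>0: "\<gamma> > 0" using \<gamma> e by linarith
  \<comment> \<open>Chosen so that e (1 + \<delta>) is the midpoint of e and 2 \<gamma>; then \<rho>
    < 2, which the factor (1 / 2) ^ n can beat.\<close>
  define \<delta> where "\<delta> = (2 * \<gamma> - exp 1) / (2 * exp 1)"
  have "\<delta> > 0" using \<gamma> by (simp add: \<delta>_def)
  then obtain M where M: "M \<ge> 1"
    "\<And>n x \<gamma>. n \<ge> 1 \<Longrightarrow> \<gamma> > 0 \<Longrightarrow> x \<ge> \<gamma> / real n \<Longrightarrow>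
       overlap_sum (1 / x) n / fact n \<le> 1 + M * (\<Sum>m=1..n. (exp 1 * (1 + \<delta>) / \<gamma>) ^ m)"
    using overlap_sum_bound by blast
  define \<rho> where "\<rho> = exp 1 * (1 + \<delta>) / \<gamma>"
  have "exp 1 * (1 + \<delta>) = exp 1 / 2 + \<gamma>"
    using e by (simp add: \<delta>_def field_simps)
  hence "\<rho> = (exp 1 / 2 + \<gamma>) / \<gamma>" unfolding \<rho>_def by (rule arg_cong)
  moreover have "1 \<le> (exp 1 / 2 + \<gamma>) / \<gamma>" "(exp 1 / 2 + \<gamma>) / \<gamma> < 2"
    using \<gamma> \<gamma>0 by (simp_all add: field_simps)
  ultimately have \<rho>: "1 \<le> \<rho>" "\<rho> < 2" by simp_all
  \<comment> \<open>As \<rho> \<ge> 1, the geometric sum is at most n \<rho> ^ n, whence the third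
    power of n.\<close>
  define u where "u n = 2 * (real n ^ 2 * (1 / 2) ^ n) + 2 * M * (real n ^ 3 * (\<rho> / 2) ^ n)" for n
  have "u \<longlonglongrightarrow> 2 * 0 + 2 * M * 0"
    unfolding u_def using \<rho>
    by (intro tendsto_add tendsto_mult tendsto_const power_mult_geometric_tendsto_0) auto
  hence "u \<longlonglongrightarrow> 0" by simp
  moreover have "\<forall>\<^sub>F n in sequentially. p n > 0 \<and> rel_second_moment (1 / p n) (diam_paths n) \<le> 1 + u n"
    using ev eventually_ge_at_top[of 1]
  proof eventually_elim
    case (elim n)
    have "\<gamma> / real n > 0" using \<gamma>0 elim by simp
    hence pn: "0 < p n" "p n \<le> 1" using elim p01 by auto
    have "(\<Sum>m=1..n. \<rho> ^ m) \<le> real (card {1..n}) * \<rho> ^ n"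
      using \<rho> by (intro sum_bounded_above power_increasing) auto
    hence "overlap_sum (1 / p n) n / fact n \<le> 1 + M * (real n * \<rho> ^ n)"
      using M(2)[OF elim(2) \<gamma>0 elim(1)] M(1) unfolding \<rho>_def[symmetric]
      by (smt (verit) card_atLeastAtMost diff_Suc_1 mult_left_mono)
    hence "2 * real n ^ 2 * (1 / 2) ^ n * (overlap_sum (1 / p n) n / fact n) \<le>
        2 * real n ^ 2 * (1 / 2) ^ n * (1 + M * (real n * \<rho> ^ n))"
      by (intro mult_left_mono) auto
    also have "\<dots> = u n"
      by (simp add: u_def power2_eq_square power3_eq_cube power_divide field_simps)
    finally have "rel_second_moment (1 / p n) (diam_paths n) \<le> 1 + u n"
      using rel_second_moment_diam_paths_le[OF elim(2), of "1 / p n"] pn by simp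
    with pn show ?case by blast
  qed
  ultimately show ?thesis using that by blast
qed

lemma second_moment_diam_paths0_bounded:
  fixes p :: "nat \<Rightarrow> real"
  assumes p01: "\<And>n. n \<ge> 1 \<Longrightarrow> 0 \<le> p n \<and> p n \<le> 1"
    and \<gamma>: "\<gamma> > exp 1" and ev: "\<forall>\<^sub>F n in sequentially. p n \<ge> \<gamma> / real n"
  obtains C where "C \<ge> 1"
    "\<forall>\<^sub>F n in sequentially. p n > 0 \<and> rel_second_moment (1 / p n) (diam_paths0 n) \<le> C"
proof -
  have e: "exp (1::real) > 0" by simp
  have \<gamma>0: "\<gamma> > 0" using \<gamma> e by linarith
  \<comment> \<open>Here e (1 + \<delta>) is the midpoint of e and \<gamma>, so that \<rho> < 1 and
    the geometric sum is bounded uniformly in n.\<close>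
  define \<delta> where "\<delta> = (\<gamma> - exp 1) / (2 * exp 1)"
  have "\<delta> > 0" using \<gamma> by (simp add: \<delta>_def)
  then obtain M where M: "M \<ge> 1"
    "\<And>n x \<gamma>. n \<ge> 1 \<Longrightarrow> \<gamma> > 0 \<Longrightarrow> x \<ge> \<gamma> / real n \<Longrightarrow>
       overlap_sum (1 / x) n / fact n \<le> 1 + M * (\<Sum>m=1..n. (exp 1 * (1 + \<delta>) / \<gamma>) ^ m)"
    using overlap_sum_bound by blast
  define \<rho> where "\<rho> = exp 1 * (1 + \<delta>) / \<gamma>"
  have "exp 1 * (1 + \<delta>) = (exp 1 + \<gamma>) / 2"
    using e by (simp add: \<delta>_def field_simps)
  hence "\<rho> = (exp 1 + \<gamma>) / 2 / \<gamma>" unfolding \<rho>_def by (rule arg_cong)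
  moreover have "0 \<le> (exp 1 + \<gamma>) / 2 / \<gamma>" "(exp 1 + \<gamma>) / 2 / \<gamma> < 1"
    using \<gamma> \<gamma>0 by (simp_all add: field_simps)
  ultimately have \<rho>: "0 \<le> \<rho>" "\<rho> < 1" by simp_all
  define C where "C = 1 + M * (\<rho> / (1 - \<rho>))"
  have "C \<ge> 1" using M \<rho> by (simp add: C_def)
  moreover have "\<forall>\<^sub>F n in sequentially. p n > 0 \<and> rel_second_moment (1 / p n) (diam_paths0 n) \<le> C"
    using ev eventually_ge_at_top[of 1]
  proof eventually_elim
    case (elim n)
    have "\<gamma> / real n > 0" using \<gamma>0 elim by simp
    hence pn: "0 < p n" "p n \<le> 1" using elim p01 by auto
    have "rel_second_moment (1 / p n) (diam_paths0 n) \<le> overlap_sum (1 / p n) n / fact n"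
      using elim pn by (intro rel_second_moment_diam_paths0_le) auto
    also have "\<dots> \<le> 1 + M * (\<Sum>m=1..n. \<rho> ^ m)"
      using M(2)[OF elim(2) \<gamma>0 elim(1)] by (simp add: \<rho>_def)
    also have "\<dots> \<le> C"
      unfolding C_def using M(1) sum_geometric_le[OF \<rho>] by (intro add_left_mono mult_left_mono) auto
    finally show ?case using pn by blast
  qed
  ultimately show ?thesis using that by blast
qed

text \<open>The value \<delta> = 1 is good enough, since the ratio 2 e / (n p n) tends to 0. The
  parameter \<gamma> of the bound is n p n itself, which is possible because \<open>M\<close> does
  not depend on it.\<close>

lemma second_moment_diam_paths0_tendsto:
  fixes p :: "nat \<Rightarrow> real"
  assumes p01: "\<And>n. n \<ge> 1 \<Longrightarrow> 0 \<le> p n \<and> p n \<le> 1"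
    and lim: "filterlim (\<lambda>n. real n * p n) at_top sequentially"
  obtains u where "u \<longlonglongrightarrow> 0"
    "\<forall>\<^sub>F n in sequentially. p n > 0 \<and> rel_second_moment (1 / p n) (diam_paths0 n) \<le> 1 + u n"
proof -
  obtain M where M: "M \<ge> 1"
    "\<And>n x \<gamma>. n \<ge> 1 \<Longrightarrow> \<gamma> > 0 \<Longrightarrow> x \<ge> \<gamma> / real n \<Longrightarrow>
       overlap_sum (1 / x) n / fact n \<le> 1 + M * (\<Sum>m=1..n. (exp 1 * (1 + 1) / \<gamma>) ^ m)"
    using overlap_sum_bound[of 1] by auto
  define x where "x n = exp 1 * (1 + 1) / (real n * p n)" for n
  have x: "x \<longlonglongrightarrow> 0" unfolding x_def
    by (rule real_tendsto_divide_at_top[OF tendsto_const lim])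
  define u where "u n = M * (x n / (1 - x n))" for n
  have "u \<longlonglongrightarrow> M * (0 / (1 - 0))"
    unfolding u_def by (intro tendsto_mult tendsto_divide tendsto_diff tendsto_const x) simp
  hence "u \<longlonglongrightarrow> 0" by simp
  moreover have "\<forall>\<^sub>F n in sequentially. p n > 0 \<and> rel_second_moment (1 / p n) (diam_paths0 n) \<le> 1 + u n"
    using order_tendstoD(2)[OF x zero_less_one] eventually_ge_at_top[of 1]
      lim[THEN filterlim_at_top_dense[THEN iffD1], rule_format, of 0]
  proof eventually_elim
    case (elim n)
    hence pn: "0 < p n" "p n \<le> 1" using p01[of n] by (auto simp: zero_less_mult_iff)
    have xn: "0 \<le> x n" "x n < 1" using elim by (auto simp: x_def)
    have "rel_second_moment (1 / p n) (diam_paths0 n) \<le> overlap_sum (1 / p n) n / fact n"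
      using elim pn by (intro rel_second_moment_diam_paths0_le) auto
    also have "\<dots> \<le> 1 + M * (\<Sum>m=1..n. x n ^ m)"
      unfolding x_def using elim by (intro M(2)) auto
    also have "\<dots> \<le> 1 + u n"
      unfolding u_def using M(1) sum_geometric_le[OF xn] by (intro add_left_mono mult_left_mono) auto
    finally show ?case using pn by blast
  qed
  ultimately show ?thesis using that by blast
qed

section \<open>Isolation of the vertex 0\<close>

lemma prob_no_path0_ge:
  assumes n: "n \<ge> 1" and p: "0 \<le> p" "p \<le> 1"
  shows "(1 - p) ^ n \<le> measure_pmf.prob (hc_law n p) {E. path_count (diam_paths0 n) E = 0}"
proof -
  define S where "S = {e \<in> hc_edges n. hc_zero n \<in> e}"
  have z: "hc_zero n \<in> hc_vertices n" by (simp add: hc_zero_def hc_vertices_def)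
  \<comment> \<open>At most \<open>n\<close> edges meet 0. An upper bound for \<open>card S\<close>
    suffices, as powers of 1 - p decrease in the exponent.\<close>
  have "S \<subseteq> (\<lambda>i. {hc_zero n, flip (hc_zero n) {i}}) ` {..<n}"
  proof
    fix e assume "e \<in> S"
    then obtain x y where xy: "e = {x, y}" "x \<in> hc_vertices n" "y \<in> hc_vertices n"
        "card {i. i < n \<and> x ! i \<noteq> y ! i} = 1" "hc_zero n = x \<or> hc_zero n = y"
      unfolding S_def hc_edges_def by blast
    have swap: "{i. i < n \<and> y ! i \<noteq> x ! i} = {i. i < n \<and> x ! i \<noteq> y ! i}" by auto
    obtain w where w: "e = {hc_zero n, w}" "w \<in> hc_vertices n"
        "card {i. i < n \<and> hc_zero n ! i \<noteq> w ! i} = 1"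
      using xy(5)
    proof
      assume "hc_zero n = x"
      thus ?thesis using xy by (intro that[of y]) simp_all
    next
      assume "hc_zero n = y"
      thus ?thesis using xy swap by (intro that[of x]) auto
    qed
    then obtain i where i: "{i. i < n \<and> hc_zero n ! i \<noteq> w ! i} = {i}"
      by (auto simp: card_1_singleton_iff)
    have "w = flip (hc_zero n) {i}"
      using hc_verticesD[OF z] hc_verticesD[OF w(2)] i by (intro nth_equalityI) auto
    moreover have "i < n" using i by blast
    ultimately show "e \<in> (\<lambda>i. {hc_zero n, flip (hc_zero n) {i}}) ` {..<n}" using w(1) by blast
  qed
  hence "card S \<le> card ((\<lambda>i. {hc_zero n, flip (hc_zero n) {i}}) ` {..<n})"
    by (intro card_mono) auto
  also have "\<dots> \<le> n" using card_image_le[of "{..<n}"] by (metis card_lessThan finite_lessThan)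
  finally have card: "card S \<le> n" .
  have "path_count (diam_paths0 n) E = 0" if "E \<inter> S = {}" for E
  proof -
    have "\<not> path_edges d \<subseteq> E" if d: "d \<in> diam_paths0 n" for d
    proof -
      obtain t where t: "t \<in> permutations_of_set {..<n}" "d = path_class (hc_zero n, t)"
        using diam_paths0_bij[OF n] d by (auto simp: bij_betw_def)
      have "walk_edge (hc_zero n) t 0 \<in> path_edges d"
        unfolding t(2) path_edges_path_class walk_edges_def
        using permutations_lessThanD(3)[OF t(1)] n by auto
      moreover have "walk_edge (hc_zero n) t 0 \<in> S"
        using walk_edge_in_hc_edges[OF z t(1), of 0] n by (simp add: S_def) (simp add: walk_edge_def)
      ultimately show ?thesis using \<open>E \<inter> S = {}\<close> by blast
    qed
    hence "{d \<in> diam_paths0 n. path_edges d \<subseteq> E} = {}" by blast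
    thus ?thesis unfolding path_count_def by (simp only: card.empty)
  qed
  hence "measure_pmf.prob (hc_law n p) {E. E \<inter> S = {}} \<le>
      measure_pmf.prob (hc_law n p) {E. path_count (diam_paths0 n) E = 0}"
    by (intro measure_pmf.finite_measure_mono) auto
  moreover have "measure_pmf.prob (hc_law n p) {E. E \<inter> S = {}} = (1 - p) ^ card S"
    by (intro prob_hc_law_disjoint p) (auto simp: S_def)
  moreover have "(1 - p) ^ n \<le> (1 - p) ^ card S" using card p by (intro power_decreasing) auto
  ultimately show ?thesis by linarith
qed

lemma prob_no_path0_bounded_below:
  fixes p :: "nat \<Rightarrow> real"
  assumes p01: "\<And>n. n \<ge> 1 \<Longrightarrow> 0 \<le> p n \<and> p n \<le> 1"
    and "limsup (\<lambda>n. ereal (real n * p n)) < \<infinity>"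
  obtains \<delta> where "\<delta> > 0" "\<forall>\<^sub>F n in sequentially.
    \<delta> \<le> measure_pmf.prob (hc_law n (p n)) {E. path_count (diam_paths0 n) E = 0}"
proof -
  obtain b :: nat where "limsup (\<lambda>n. ereal (real n * p n)) < ereal (real b)"
    using assms(2) less_PInf_Ex_of_nat by auto
  hence b: "\<forall>\<^sub>F n in sequentially. real n * p n < real b"
    using Limsup_lessD by fastforce
  have "(\<lambda>n. (1 + (- real b) / real n) ^ n) \<longlonglongrightarrow> exp (- real b)"
    by (rule tendsto_exp_limit_sequentially)
  hence lim: "\<forall>\<^sub>F n in sequentially. exp (- real b) / 2 < (1 + (- real b) / real n) ^ n"
    by (rule order_tendstoD) simp
  have "\<forall>\<^sub>F n in sequentially.
      exp (- real b) / 2 \<le> measure_pmf.prob (hc_law n (p n)) {E. path_count (diam_paths0 n) E = 0}"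
    \<comment> \<open>For n > b the base 1 - b / n is nonnegative, as monotonicity of powers
      requires.\<close>
    using b lim eventually_ge_at_top[of "Suc b"]
  proof eventually_elim
    case (elim n)
    have "1 + (- real b) / real n \<le> 1 - p n" "0 \<le> 1 + (- real b) / real n"
      using elim by (simp_all add: field_simps)
    hence "(1 + (- real b) / real n) ^ n \<le> (1 - p n) ^ n" by (intro power_mono)
    also have "\<dots> \<le> measure_pmf.prob (hc_law n (p n)) {E. path_count (diam_paths0 n) E = 0}"
      using elim p01[of n] by (intro prob_no_path0_ge) auto
    finally show ?case using elim by linarith
  qed
  thus ?thesis by (intro that[of "exp (- real b) / 2"]) auto
qed

theorem theorem1:
  fixes p :: "nat \<Rightarrow> real"
  assumes p01: "\<And>n. n \<ge> 1 \<Longrightarrow> 0 \<le> p n \<and> p n \<le> 1"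
  defines "P \<equiv> (\<lambda>n. hc_law n (p n))"
      and "Ptam \<equiv> (\<lambda>n. hc_law_tam n (p n))"
      and "Ptam0 \<equiv> (\<lambda>n. hc_law_tam0 n (p n))"
  shows
    "((\<exists>\<gamma><exp 1 / 2. \<forall>\<^sub>F n in sequentially. p n \<le> \<gamma> / real n) \<longrightarrow>
        detectable P Ptam \<and> converges_to_delta0 P N_diam)
   \<and> ((\<exists>\<gamma>>exp 1 / 2. \<forall>\<^sub>F n in sequentially. p n \<ge> \<gamma> / real n) \<longrightarrow>
        strongly_undetectable P Ptam \<and>
        (strongly_undetectable P Ptam \<longleftrightarrow> weak_law_large_numbers P N_diam))
   \<and> ((\<exists>\<gamma><exp 1. \<forall>\<^sub>F n in sequentially. p n \<le> \<gamma> / real n) \<longrightarrow>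
        detectable P Ptam0 \<and> converges_to_delta0 P N_diam0)
   \<and> ((\<exists>\<gamma>>exp 1. \<forall>\<^sub>F n in sequentially. p n \<ge> \<gamma> / real n) \<and>
        limsup (\<lambda>n. ereal (real n * p n)) < \<infinity> \<longrightarrow>
        weakly_undetectable P Ptam0 \<and> \<not> weak_law_large_numbers P N_diam0)
   \<and> (filterlim (\<lambda>n. real n * p n) at_top sequentially \<longrightarrow>
        strongly_undetectable P Ptam0 \<and>
        (strongly_undetectable P Ptam0 \<longleftrightarrow> weak_law_large_numbers P N_diam0))"
proof -
  interpret all: planted_paths p diam_paths
    using p01 diam_paths_nonempty by unfold_locales auto
  interpret zero: planted_paths p diam_paths0
    using p01 diam_paths0_nonempty diam_paths0_subset by unfold_locales auto
  have N: "N_diam = (\<lambda>n. path_count (diam_paths n))" "N_diam0 = (\<lambda>n. path_count (diam_paths0 n))"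
    by (simp_all add: N_diam_def N_diam0_def path_count_def fun_eq_iff)
  have tam: "Ptam = (\<lambda>n. tamper (hc_law n (p n)) (diam_paths n))"
    "Ptam0 = (\<lambda>n. tamper (hc_law n (p n)) (diam_paths0 n))"
    by (simp_all add: Ptam_def Ptam0_def hc_law_tam_def hc_law_tam0_def)
  note defs = P_def tam N
  show ?thesis
  proof (intro conjI impI)
    assume "\<exists>\<gamma><exp 1 / 2. \<forall>\<^sub>F n in sequentially. p n \<le> \<gamma> / real n"
    then obtain \<gamma> where \<gamma>: "\<gamma> < exp 1 / 2" "\<forall>\<^sub>F n in sequentially. p n \<le> \<gamma> / real n" by blast
    \<comment> \<open>The factor 1 / 2 for forgetting the orientation is dropped; only the base 2
      determines the threshold.\<close>
    have "real (card (diam_paths n)) \<le> 2 ^ n * fact n" if "n \<ge> 1" for n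
      using card_diam_paths[OF that] by linarith
    hence lim: "(\<lambda>n. real (card (diam_paths n)) * p n ^ n) \<longlonglongrightarrow> 0"
      using \<gamma> p01 by (intro expectation_diam_paths_tendsto_0[of p diam_paths 2 \<gamma>]) auto
    show "detectable P Ptam" "converges_to_delta0 P N_diam"
      unfolding defs
      by (fact all.detectable_if_expectation_tendsto_0[OF lim]
          all.converges_to_delta0_if_expectation_tendsto_0[OF lim])+
  next
    assume "\<exists>\<gamma>>exp 1 / 2. \<forall>\<^sub>F n in sequentially. p n \<ge> \<gamma> / real n"
    then obtain \<gamma> where "\<gamma> > exp 1 / 2" "\<forall>\<^sub>F n in sequentially. p n \<ge> \<gamma> / real n" by blast
    from second_moment_diam_paths[OF p01 this] obtain u where u: "u \<longlonglongrightarrow> 0"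
      "\<forall>\<^sub>F n in sequentially. p n > 0 \<and> rel_second_moment (1 / p n) (diam_paths n) \<le> 1 + u n" by blast
    show su: "strongly_undetectable P Ptam"
      unfolding defs by (rule all.strongly_undetectable_if_second_moment[OF u(2,1)])
    have "weak_law_large_numbers P N_diam"
      unfolding defs by (rule all.weak_law_if_second_moment[OF u(2,1)])
    \<comment> \<open>In this regime both sides of the equivalence hold, by the same second moment
      bound.\<close>
    with su show "strongly_undetectable P Ptam \<longleftrightarrow> weak_law_large_numbers P N_diam" by simp
  next
    assume "\<exists>\<gamma><exp 1. \<forall>\<^sub>F n in sequentially. p n \<le> \<gamma> / real n"
    then obtain \<gamma> where \<gamma>: "\<gamma> < exp 1" "\<forall>\<^sub>F n in sequentially. p n \<le> \<gamma> / real n" by blast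
    have lim: "(\<lambda>n. real (card (diam_paths0 n)) * p n ^ n) \<longlonglongrightarrow> 0"
      using \<gamma> p01 card_diam_paths0
      by (intro expectation_diam_paths_tendsto_0[of p diam_paths0 1 \<gamma>]) auto
    show "detectable P Ptam0" "converges_to_delta0 P N_diam0"
      unfolding defs
      by (fact zero.detectable_if_expectation_tendsto_0[OF lim]
          zero.converges_to_delta0_if_expectation_tendsto_0[OF lim])+
  next
    assume A: "(\<exists>\<gamma>>exp 1. \<forall>\<^sub>F n in sequentially. p n \<ge> \<gamma> / real n) \<and>
        limsup (\<lambda>n. ereal (real n * p n)) < \<infinity>"
    then obtain \<gamma> where "\<gamma> > exp 1" "\<forall>\<^sub>F n in sequentially. p n \<ge> \<gamma> / real n" by blast
    from second_moment_diam_paths0_bounded[OF p01 this] obtain C where C: "C \<ge> 1"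
      "\<forall>\<^sub>F n in sequentially. p n > 0 \<and> rel_second_moment (1 / p n) (diam_paths0 n) \<le> C" by blast
    from prob_no_path0_bounded_below[OF p01 conjunct2[OF A]]
    obtain \<delta> where \<delta>: "\<delta> > 0" "\<forall>\<^sub>F n in sequentially.
        \<delta> \<le> measure_pmf.prob (hc_law n (p n)) {E. path_count (diam_paths0 n) E = 0}" by blast
    show "weakly_undetectable P Ptam0"
      unfolding defs by (rule zero.weakly_undetectable_if_bounded[OF C(2,1) \<delta>])
    show "\<not> weak_law_large_numbers P N_diam0"
      unfolding defs by (rule zero.not_weak_law_if_no_path[OF \<delta>])
  next
    assume "filterlim (\<lambda>n. real n * p n) at_top sequentially"
    from second_moment_diam_paths0_tendsto[OF p01 this] obtain u where u: "u \<longlonglongrightarrow> 0"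
      "\<forall>\<^sub>F n in sequentially. p n > 0 \<and> rel_second_moment (1 / p n) (diam_paths0 n) \<le> 1 + u n" by blast
    show su: "strongly_undetectable P Ptam0"
      unfolding defs by (rule zero.strongly_undetectable_if_second_moment[OF u(2,1)])
    have "weak_law_large_numbers P N_diam0"
      unfolding defs by (rule zero.weak_law_if_second_moment[OF u(2,1)])
    with su show "strongly_undetectable P Ptam0 \<longleftrightarrow> weak_law_large_numbers P N_diam0" by simp
  qed
qed

end
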